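(* For $p=0,1,2,\dots$ let $d_p:G_p^\infty\times G_p^\infty\to[0,\infty]$ be metrics such that, for $p\neq0$: (I) $d_p(V,W)=f_p(\theta_1,\dots,\theta_p)$ for a nondecreasing function $f_p$ of the principal angles $\theta_1\le\cdots\le\theta_p$ of $V,W\in G_p^\infty$; (II) $f_q(0,\dots,0,\theta_1,\dots,\theta_p)=f_p(\theta_1,\dots,\theta_p)$ for $q>p$ and any $\theta_1,\dots,\theta_p$. Let $\operatorname{diam}G_p^\infty=\sup\{d_p(V,W):V,W\in G_p^\infty\}$, and let $\inf_p$ denote the infimum taken in the ordered set $[0,\operatorname{diam}G_p^\infty]$ (so that $\inf_p\emptyset=\operatorname{diam}G_p^\infty$). Then an asymmetric metric $d:G^\infty\times G^\infty\to[0,\infty]$ is given by $$d(V,W)=\inf\nolimits_p\{d_p(V,W'):W'\in G_p(W)\},\qquad p=\dim V.$$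
   Context: $\mathbb{F}=\mathbb{R}$ or $\mathbb{C}$, and each $\mathbb{F}^n$ has its inner product, compatible with the canonical inclusions $\mathbb{F}^n\subset\mathbb{F}^{n+1}$. $G_p(W)$ is the set of $p$-dimensional subspaces of $W$ (empty if $p>\dim W$), and $G(\mathbb{F}^n)$ is the set of all subspaces of $\mathbb{F}^n$. Via the inclusions $\mathbb{F}^n\subset\mathbb{F}^{n+1}$, $G_p(\mathbb{F}^n)\subset G_p(\mathbb{F}^{n+1})$; $G_p^\infty=\bigcup_nG_p(\mathbb{F}^n)$ is the set of all $p$-subspaces of all $\mathbb{F}^n$'s (with $G_0^\infty=\{\{0\}\}$), and $G^\infty=\bigcup_nG(\mathbb{F}^n)=\bigcup_{p\ge0}G_p^\infty$. Principal angles: for nonzero subspaces $V,W$ of dimensions $p,q$, with $m=\min\{p,q\}$, the principal angles $0\le\theta_1\le\cdots\le\theta_m\le\frac\pi2$ are the numbers for which there are orthonormal bases $(e_1,\dots,e_p)$ of $V$ and $(f_1,\dots,f_q)$ of $W$ with $\langle e_i,f_j\rangle=0$ for $i\ne j$ and $\langle e_i,f_i\rangle=\cos\theta_i$ for $1\le i\le m$ (equivalently, $\cos\theta_1\ge\cdots\ge\cos\theta_m$ are the singular values of the orthogonal projection $V\to W$). The functions $f_p$ are defined on nondecreasing $p$-tuples of angles in $[0,\frac\pi2]$, and "nondecreasing" means nondecreasing in the angles ($f_p(\theta)\le f_p(\theta')$ if $\theta_i\le\theta_i'$ for all $i$). Metrics $d_p$ are in the usual sense, with the value $\infty$ allowed.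 An asymmetric metric on a non-empty set $M$ is a function $d:M\times M\to[0,\infty]$ with $d(x,y)=d(y,x)=0\Leftrightarrow x=y$ and $d(x,z)\le d(x,y)+d(y,z)$ for all $x,y,z\in M$. *)

theory Defs
  imports "HOL-Analysis.Analysis" "HOL-Library.Poly_Mapping"
begin

section \<open>The scalar field\<close>

text \<open>
  The class of scalar fields \<open>\<F>\<close> with \<open>\<F> = \<real>\<close> or \<open>\<F> = \<complex>\<close>, carrying the conjugation \<open>cjg\<close>
  (the identity on \<open>\<real>\<close>).  Both fields are instances, and the lemma
  \<open>real_or_complex_cases\<close> shows that there are no others up to isomorphism.
\<close>

class real_or_complex = real_normed_field + euclidean_space +
  fixes cjg :: "'a \<Rightarrow> 'a"
  assumes cjg_add: "cjg (x + y) = cjg x + cjg y"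
    and cjg_mult: "cjg (x * y) = cjg x * cjg y"
    and mult_cjg_scaleR: "x * cjg x = (norm x)\<^sup>2 *\<^sub>R 1"

instantiation real :: real_or_complex
begin

definition cjg_real :: "real \<Rightarrow> real" where
  "cjg_real x = x"

instance
  by standard (simp_all add: cjg_real_def power2_eq_square)

end

instantiation complex :: real_or_complex
begin

definition cjg_complex :: "complex \<Rightarrow> complex" where
  "cjg_complex = cnj"

instance
proof
  fix x y :: complex
  show "cjg (x + y) = cjg x + cjg y" "cjg (x * y) = cjg x * cjg y"
    by (simp_all add: cjg_complex_def)
  show "x * cjg x = (norm x)\<^sup>2 *\<^sub>R 1"
    by (metis cjg_complex_def complex_norm_square of_real_def)
qed

end

lemma mult_cjg: "x * cjg x = of_real ((norm x)\<^sup>2)" for x :: "'a :: real_or_complex"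
  by (simp add: mult_cjg_scaleR of_real_def)

lemma one_inner_one: "1 \<bullet> (1 :: 'a :: {real_normed_field, euclidean_space}) = 1"
  by (simp add: power2_norm_eq_inner[symmetric])

lemma square_eq_minus_one:
  fixes u :: "'a :: {real_normed_field, euclidean_space}"
  assumes "norm u = 1" "u \<bullet> 1 = 0"
  shows "u * u = - 1"
proof -
  have n: "norm (1 + u) ^ 2 = 2" "norm (1 - u) ^ 2 = 2"
    using assms
    by (simp_all add: one_inner_one power2_norm_eq_inner inner_simps inner_commute norm_eq_1)
  have n3: "norm (u * u) = 1"
    using assms by (simp add: norm_mult)
  have "norm (1 - u * u) ^ 2 = norm (1 + u) ^ 2 * norm (1 - u) ^ 2"
    by (simp add: norm_mult[symmetric] power_mult_distrib[symmetric] algebra_simps)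
  then have "norm (1 - u * u) ^ 2 = 4"
    using n by simp
  then have "(u * u) \<bullet> 1 = - 1"
    using n3 by (simp add: one_inner_one power2_norm_eq_inner inner_simps inner_commute norm_eq_1)
  then have "norm (u * u + 1) ^ 2 = 0"
    using n3 by (simp add: one_inner_one power2_norm_eq_inner inner_simps inner_commute norm_eq_1)
  then show ?thesis
    by (simp add: eq_neg_iff_add_eq_0)
qed

lemma real_or_complex_cases:
  "(\<forall>x :: 'a :: real_or_complex. x \<in> \<real>) \<or>
   (\<exists>i :: 'a. i * i = - 1 \<and> cjg i = - i \<and> (\<forall>x. \<exists>a b. x = of_real a + of_real b * i))"
proof (cases "\<forall>x :: 'a. x \<in> \<real>")
  case False
  then obtain x :: 'a where x: "x \<notin> \<real>" by blast
  have dec: "\<exists>a b u. y = of_real a + of_real b * u \<and> norm u = 1 \<and> u * u = - 1"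
    if "y \<notin> \<real>" for y :: 'a
  proof -
    define w where "w = y - of_real (y \<bullet> 1)"
    define u where "u = w /\<^sub>R norm w"
    have "w \<noteq> 0"
      using that by (metis Reals_of_real eq_iff_diff_eq_0 w_def)
    have "w \<bullet> 1 = 0"
      by (simp add: w_def inner_simps of_real_def one_inner_one)
    then have "u \<bullet> 1 = 0" "norm u = 1"
      using \<open>w \<noteq> 0\<close> by (simp_all add: u_def)
    moreover have "of_real (norm w) * u = w"
      using \<open>w \<noteq> 0\<close> by (simp add: u_def scaleR_conv_of_real)
    then have "y = of_real (y \<bullet> 1) + of_real (norm w) * u"
      by (simp add: w_def)
    ultimately show ?thesis
      using square_eq_minus_one by blast
  qed
  obtain u :: 'a where u: "norm u = 1" "u * u = - 1"
    using dec[OF x] by blast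
  have "u * cjg u = u * (- u)"
    using u mult_cjg[of u] by simp
  then have "cjg u = - u"
    using u(1) by (metis mult_left_cancel norm_zero zero_neq_one)
  moreover have "\<exists>a b. y = of_real a + of_real b * u" for y
  proof (cases "y \<in> \<real>")
    case True
    then show ?thesis
      by (metis Reals_cases add.right_neutral mult_zero_left of_real_0)
  next
    case False
    then obtain a b v where v: "y = of_real a + of_real b * v" "v * v = - 1"
      using dec by blast
    then have "v = u \<or> v = - u"
      using u(2) square_eq_iff by metis
    then show ?thesis
      using v(1) by (metis mult_minus_left mult_minus_right of_real_minus)
  qed
  ultimately show ?thesis
    using u(2) by blast
qed blast


section \<open>The spaces \<open>\<F>\<^sup>n\<close> and their inner product\<close>

text \<open>
  All the \<open>\<F>\<^sup>n\<close> are realised inside their union, the space of finitely supported sequences, so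
  that the canonical inclusions \<open>\<F>\<^sup>n \<subseteq> \<F>\<^sup>n\<^sup>+\<^sup>1\<close> are inclusions of sets.
\<close>

type_synonym 'a fseq = "nat \<Rightarrow>\<^sub>0 'a"

lift_definition scl :: "'a :: field \<Rightarrow> 'a fseq \<Rightarrow> 'a fseq"
  is "\<lambda>c x i. c * x i"
  by (auto elim: rev_finite_subset)

global_interpretation fsp: vector_space "scl :: 'a :: field \<Rightarrow> 'a fseq \<Rightarrow> 'a fseq"
  defines fspan = fsp.span
    and fsubspace = fsp.subspace
    and fdim = fsp.dim
  by standard
    (transfer, simp add: fun_eq_iff algebra_simps)+

definition coord_space :: "nat \<Rightarrow> ('a :: field) fseq set" where
  "coord_space n = {x. \<forall>i\<ge>n. Poly_Mapping.lookup x i = 0}"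

definition hinner :: "('a :: real_or_complex) fseq \<Rightarrow> 'a fseq \<Rightarrow> 'a" where
  "hinner x y = (\<Sum>i\<in>Poly_Mapping.keys x. Poly_Mapping.lookup x i * cjg (Poly_Mapping.lookup y i))"


section \<open>Grassmannians\<close>

definition Gr :: "nat \<Rightarrow> ('a :: field) fseq set \<Rightarrow> 'a fseq set set" where
  "Gr p W = {V. fsubspace V \<and> V \<subseteq> W \<and> fdim V = p}"

definition Gr_inf :: "nat \<Rightarrow> ('a :: field) fseq set set" where
  "Gr_inf p = (\<Union>n. Gr p (coord_space n))"

definition full_Gr :: "('a :: field) fseq set \<Rightarrow> 'a fseq set set" where
  "full_Gr W = {V. fsubspace V \<and> V \<subseteq> W}"

definition full_Gr_inf :: "('a :: field) fseq set set" where
  "full_Gr_inf = (\<Union>n. full_Gr (coord_space n))"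


section \<open>Principal angles\<close>

definition orthonormal_basis :: "('a :: real_or_complex) fseq list \<Rightarrow> 'a fseq set \<Rightarrow> bool" where
  "orthonormal_basis e V \<longleftrightarrow>
     (\<forall>i < length e. \<forall>j < length e. hinner (e ! i) (e ! j) = (if i = j then 1 else 0)) \<and>
     fspan (set e) = V"

definition angle_tuple :: "nat \<Rightarrow> real list \<Rightarrow> bool" where
  "angle_tuple m \<theta> \<longleftrightarrow> length \<theta> = m \<and> sorted \<theta> \<and> set \<theta> \<subseteq> {0..pi/2}"

text \<open>The list \<open>\<theta>\<close> holds \<open>\<theta>\<^sub>1 \<le> \<dots> \<le> \<theta>\<^sub>m\<close>, with indices shifted to start at 0.\<close>

definition principal_angles ::
    "('a :: real_or_complex) fseq set \<Rightarrow> 'a fseq set \<Rightarrow> real list \<Rightarrow> bool" where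
  "principal_angles V W \<theta> \<longleftrightarrow>
     angle_tuple (min (fdim V) (fdim W)) \<theta> \<and>
     (\<exists>e f. orthonormal_basis e V \<and> orthonormal_basis f W \<and>
        (\<forall>i < length e. \<forall>j < length f. i \<noteq> j \<longrightarrow> hinner (e ! i) (f ! j) = 0) \<and>
        (\<forall>i < min (fdim V) (fdim W). hinner (e ! i) (f ! i) = of_real (cos (\<theta> ! i))))"

text \<open>Nondecreasing in the angles, not merely along a single tuple.\<close>

definition nondecreasing_angle_fun :: "nat \<Rightarrow> (real list \<Rightarrow> ennreal) \<Rightarrow> bool" where
  "nondecreasing_angle_fun p f \<longleftrightarrow>
     (\<forall>\<theta> \<theta>'. angle_tuple p \<theta> \<and> angle_tuple p \<theta>' \<and> list_all2 (\<le>) \<theta> \<theta>' \<longrightarrow> f \<theta> \<le> f \<theta>')"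


section \<open>Metrics with values in \<open>[0, \<infinity>]\<close>\<close>

definition ext_metric_on :: "'b set \<Rightarrow> ('b \<Rightarrow> 'b \<Rightarrow> ennreal) \<Rightarrow> bool" where
  "ext_metric_on M d \<longleftrightarrow>
     (\<forall>x\<in>M. \<forall>y\<in>M. d x y = 0 \<longleftrightarrow> x = y) \<and>
     (\<forall>x\<in>M. \<forall>y\<in>M. d x y = d y x) \<and>
     (\<forall>x\<in>M. \<forall>y\<in>M. \<forall>z\<in>M. d x z \<le> d x y + d y z)"

definition asymmetric_metric_on :: "'b set \<Rightarrow> ('b \<Rightarrow> 'b \<Rightarrow> ennreal) \<Rightarrow> bool" where
  "asymmetric_metric_on M d \<longleftrightarrow>
     M \<noteq> {} \<and>
     (\<forall>x\<in>M. \<forall>y\<in>M. d x y = 0 \<and> d y x = 0 \<longleftrightarrow> x = y) \<and>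
     (\<forall>x\<in>M. \<forall>y\<in>M. \<forall>z\<in>M. d x z \<le> d x y + d y z)"

definition diam_on :: "'b set \<Rightarrow> ('b \<Rightarrow> 'b \<Rightarrow> ennreal) \<Rightarrow> ennreal" where
  "diam_on M d = Sup {d x y | x y. x \<in> M \<and> y \<in> M}"

text \<open>The infimum of \<open>S\<close> in the ordered set \<open>[0, D]\<close>.\<close>

definition Inf_upto :: "ennreal \<Rightarrow> ennreal set \<Rightarrow> ennreal" where
  "Inf_upto D S = (GREATEST b. b \<in> {0..D} \<and> (\<forall>s\<in>S. b \<le> s))"

lemma Inf_upto_eq: "Inf_upto D S = min D (Inf S)"
  unfolding Inf_upto_def
  by (rule Greatest_equality) (auto simp: le_Inf_iff min.coboundedI2 Inf_lower)

lemma Inf_upto_empty: "Inf_upto D {} = D"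
  by (simp add: Inf_upto_eq)

end

theory Submission
  imports Defs
begin

text \<open>
  The only hard point is the triangle inequality \<open>d(U, W) \<le> d(U, V) + d(V, W)\<close>, and there the case
  \<open>p = dim U \<le> q = dim V \<le> dim W\<close>.  Given a \<open>p\<close>-dimensional \<open>V' \<subseteq> V\<close> and a \<open>q\<close>-dimensional \<open>W' \<subseteq> W\<close>,
  one needs a \<open>p\<close>-dimensional \<open>W'' \<subseteq> W'\<close> with \<open>d\<^sub>p(V', W'') \<le> d\<^sub>q(V, W')\<close>
  (\<open>subspace_approximation\<close>); the triangle inequality for \<open>d\<^sub>p\<close> then gives
  \<open>d(U, W) \<le> d\<^sub>p(U, W'') \<le> d\<^sub>p(U, V') + d\<^sub>q(V, W')\<close>, and one takes infima.

  For \<open>W''\<close> one takes a subspace of \<open>W'\<close> that contains the orthogonal projection of \<open>V'\<close>.  Then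
  \<open>V'\<close>, \<open>W''\<close> have the same principal angles as \<open>V'\<close>, \<open>W'\<close> (\<open>principal_angles_subspace\<close>).  The
  cosines of the latter are singular values of the restriction to \<open>V'\<close> of the projection
  \<open>V \<rightarrow> W'\<close>, and restricting a map to a subspace of codimension \<open>q - p\<close> can raise the \<open>k\<close>-th angle to
  no more than the \<open>(q - p + k)\<close>-th angle of the whole map (\<open>principal_angles_interlacing\<close>).  So the
  angles of \<open>V'\<close>, \<open>W''\<close>, preceded by \<open>q - p\<close> zeros, are bounded by those of \<open>V\<close>, \<open>W'\<close>, which is what
  monotonicity and the compatibility of the \<open>f\<^sub>p\<close> under adjoining zeros can exploit.

  This comparison presupposes that any two subspaces have principal angles
  (\<open>principal_angles_exist\<close>), the singular value decomposition: maximise \<open>\<bar>\<langle>v, w\<rangle>\<bar>\<close> over unit vectors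
  and continue in the orthogonal complements of the maximising pair.

  When one of the dimension inequalities fails, a diameter stands on the right-hand side, and
  diameters do not decrease with the dimension (\<open>diam_mono\<close>) because common orthogonal directions
  can always be adjoined.  Two subspaces at distance zero in both directions have the same dimension
  since \<open>diam G\<^sub>p > 0\<close> for \<open>p > 0\<close>, and then the metric \<open>d\<^sub>p\<close> separates them.
\<close>

section \<open>The inner product of finitely supported sequences\<close>

text \<open>
The class fixes only additivity, multiplicativity and \<open>x * cjg x = \<bar>x\<bar>\<^sup>2\<close>; the usual properties
of conjugation follow by cancelling \<open>x\<close> in the last law.
\<close>

lemma cjg_0 [simp]: "cjg (0 :: 'a :: real_or_complex) = 0"
  using cjg_add[of "0 :: 'a" 0] by simp

lemma cjg_sum: "cjg (\<Sum>i\<in>A. g i) = (\<Sum>i\<in>A. cjg (g i :: 'a :: real_or_complex))"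
  by (induction A rule: infinite_finite_induct) (simp_all add: cjg_add)

lemma cjg_minus: "cjg (- x) = - cjg (x :: 'a :: real_or_complex)"
  using cjg_add[of x "- x"] by (simp add: eq_neg_iff_add_eq_0 add.commute)

lemma norm_cjg [simp]: "norm (cjg x) = norm (x :: 'a :: real_or_complex)"
proof (cases "x = 0")
  case False
  have "norm x * norm (cjg x) = norm x * norm x"
    using arg_cong[OF mult_cjg[of x], of norm] by (simp add: norm_mult power2_eq_square)
  with False show ?thesis by simp
qed simp

lemma cjg_cjg [simp]: "cjg (cjg x) = (x :: 'a :: real_or_complex)"
proof (cases "x = 0")
  case False
  have "cjg x * cjg (cjg x) = cjg x * x"
    using mult_cjg[of x] mult_cjg[of "cjg x"] by (simp add: mult.commute)
  moreover have "cjg x \<noteq> 0"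
    using False norm_cjg[of x] by fastforce
  ultimately show ?thesis by simp
qed simp

lemma cjg_of_real [simp]: "cjg (of_real r) = (of_real r :: 'a :: real_or_complex)"
proof (cases "r = 0")
  case False
  have "of_real r * cjg (of_real r) = (of_real r * of_real r :: 'a)"
    using mult_cjg[of "of_real r :: 'a"] by (simp add: power2_eq_square)
  with False show ?thesis by simp
qed simp

lemma cjg_1 [simp]: "cjg 1 = (1 :: 'a :: real_or_complex)"
  using cjg_of_real[of 1] by (simp del: cjg_of_real)

lemma hinner_supset:
  assumes "finite S" "Poly_Mapping.keys x \<subseteq> S"
  shows "hinner x y = (\<Sum>i\<in>S. Poly_Mapping.lookup x i * cjg (Poly_Mapping.lookup y i))"
  unfolding hinner_def using assms
  by (intro sum.mono_neutral_left) (auto simp: in_keys_iff)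

lemma hinner_add_left: "hinner (x + y) z = hinner x z + hinner y z"
proof -
  let ?S = "Poly_Mapping.keys x \<union> Poly_Mapping.keys y"
  have "Poly_Mapping.keys (x + y) \<subseteq> ?S" by (rule Poly_Mapping.keys_add)
  then show ?thesis
    by (simp add: hinner_supset[of ?S] lookup_add sum.distrib algebra_simps)
qed

lemma hinner_scl_left: "hinner (scl c x) z = c * hinner x z"
proof -
  have "Poly_Mapping.keys (scl c x) \<subseteq> Poly_Mapping.keys x"
    by (auto simp: in_keys_iff scl.rep_eq)
  then show ?thesis
    by (simp add: hinner_supset[of "Poly_Mapping.keys x"] scl.rep_eq sum_distrib_left mult.assoc)
qed

lemma hinner_commute: "hinner y x = cjg (hinner x y)"
proof -
  let ?S = "Poly_Mapping.keys x \<union> Poly_Mapping.keys y"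
  show ?thesis
    by (simp add: hinner_supset[of ?S] cjg_sum cjg_mult mult.commute)
qed

lemma hinner_add_right: "hinner z (x + y) = hinner z x + hinner z y"
  by (metis hinner_commute hinner_add_left cjg_add)

lemma hinner_scl_right: "hinner z (scl c x) = cjg c * hinner z x"
  by (metis hinner_commute hinner_scl_left cjg_mult)

lemma hinner_0_left [simp]: "hinner 0 x = 0"
  by (simp add: hinner_def)

lemma hinner_0_right [simp]: "hinner x 0 = 0"
  by (simp add: hinner_def)

lemma hinner_sum_left: "hinner (\<Sum>i\<in>A. g i) x = (\<Sum>i\<in>A. hinner (g i) x)"
  by (induction A rule: infinite_finite_induct) (simp_all add: hinner_add_left)

lemma hinner_sum_right: "hinner x (\<Sum>i\<in>A. g i) = (\<Sum>i\<in>A. hinner x (g i))"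
  by (induction A rule: infinite_finite_induct) (simp_all add: hinner_add_right)

lemma hinner_minus_left: "hinner (- y) z = - hinner y z"
  using hinner_add_left[of y "- y" z] by (simp add: eq_neg_iff_add_eq_0 add.commute)

lemma hinner_diff_left: "hinner (x - y) z = hinner x z - hinner y z"
  using hinner_add_left[of x "- y" z] by (simp add: hinner_minus_left)

lemmas hinner_simps = hinner_add_left hinner_add_right hinner_diff_left
  hinner_scl_left hinner_scl_right hinner_sum_left hinner_sum_right

text \<open>
The Hilbert norm on the finitely supported sequences, as an \<open>\<ell>\<^sup>2\<close> sum, so that the Cauchy-Schwarz
inequality is that for finite sums of reals.
\<close>

definition hnorm :: "('a :: real_or_complex) fseq \<Rightarrow> real" where
  "hnorm x = L2_set (\<lambda>i. norm (Poly_Mapping.lookup x i)) (Poly_Mapping.keys x)"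

lemma hnorm_nonneg [simp]: "0 \<le> hnorm x"
  by (simp add: hnorm_def)

lemma hinner_self: "hinner x x = of_real ((hnorm x)\<^sup>2)"
  by (simp add: hinner_def hnorm_def L2_set_def sum_nonneg mult_cjg)

lemma hnorm_eq_0_iff [simp]: "hnorm x = 0 \<longleftrightarrow> x = 0"
  by (auto simp: hnorm_def L2_set_eq_0_iff in_keys_iff) (metis poly_mapping_eqI lookup_zero)

lemma hnorm_0 [simp]: "hnorm 0 = 0"
  by simp

lemma hnorm_scl: "hnorm (scl c x) = norm c * hnorm x"
proof -
  have "of_real ((hnorm (scl c x))\<^sup>2) = (of_real ((norm c * hnorm x)\<^sup>2) :: 'a)"
    unfolding hinner_self[symmetric] hinner_simps mult.assoc[symmetric] mult_cjg
    by (simp add: hinner_self power_mult_distrib mult_cjg mult.commute[of "cjg c"])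
  then have "(hnorm (scl c x))\<^sup>2 = (norm c * hnorm x)\<^sup>2"
    by (simp only: of_real_eq_iff)
  then show ?thesis by (simp add: power2_eq_iff_nonneg)
qed

lemma hinner_Cauchy_Schwarz: "norm (hinner x y) \<le> hnorm x * hnorm y"
proof -
  let ?S = "Poly_Mapping.keys x \<union> Poly_Mapping.keys y"
  have ext: "hnorm z = L2_set (\<lambda>i. norm (Poly_Mapping.lookup z i)) ?S"
    if "Poly_Mapping.keys z \<subseteq> ?S" for z :: "'a fseq"
    unfolding hnorm_def L2_set_def using that
    by (intro arg_cong[of _ _ sqrt] sum.mono_neutral_left) (auto simp: in_keys_iff)
  have "norm (hinner x y) \<le> (\<Sum>i\<in>?S. norm (Poly_Mapping.lookup x i * cjg (Poly_Mapping.lookup y i)))"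
    by (simp add: hinner_supset[of ?S] norm_sum)
  also have "\<dots> \<le> hnorm x * hnorm y"
    using L2_set_mult_ineq[of "\<lambda>i. norm (Poly_Mapping.lookup x i)"
        "\<lambda>i. norm (Poly_Mapping.lookup y i)" ?S]
    by (simp add: norm_mult ext)
  finally show ?thesis .
qed

lemma hinner_eq_0_commute: "hinner x y = 0 \<longleftrightarrow> hinner y x = 0"
  by (metis hinner_commute cjg_0)

section \<open>Orthonormal lists\<close>

definition orthonormal :: "('a :: real_or_complex) fseq list \<Rightarrow> bool" where
  "orthonormal e \<longleftrightarrow>
     (\<forall>i < length e. \<forall>j < length e. hinner (e ! i) (e ! j) = (if i = j then 1 else 0))"

lemma orthonormal_basis_iff: "orthonormal_basis e V \<longleftrightarrow> orthonormal e \<and> fspan (set e) = V"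
  by (simp add: orthonormal_basis_def orthonormal_def)

lemma hinner_span_0:
  assumes "x \<in> fspan S" "\<And>s. s \<in> S \<Longrightarrow> hinner s y = 0"
  shows "hinner x y = 0"
  using assms(1)
proof (induction rule: fsp.span_induct)
  case base
  show ?case by (auto simp: fsp.subspace_def hinner_simps)
qed (use assms(2) in auto)

lemma orthonormal_expansion:
  assumes "orthonormal e" "x \<in> fspan (set e)"
  shows "x = (\<Sum>i<length e. scl (hinner x (e ! i)) (e ! i))"
  using assms(2)
proof (induction rule: fsp.span_induct)
  case base
  show ?case
  proof (rule fsp.subspaceI; unfold mem_Collect_eq)
    fix c x
    assume x: "x = (\<Sum>i<length e. scl (hinner x (e ! i)) (e ! i))"
    show "scl c x = (\<Sum>i<length e. scl (hinner (scl c x) (e ! i)) (e ! i))"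
      unfolding hinner_scl_left
      by (rule trans[OF arg_cong[OF x, of "scl c"]]) (simp add: fsp.scale_sum_right)
  qed (simp_all add: hinner_add_left fsp.scale_left_distrib sum.distrib)
next
  case (step y)
  then obtain k where k: "k < length e" "y = e ! k"
    by (auto simp: in_set_conv_nth)
  have "(\<Sum>i<length e. scl (hinner y (e ! i)) (e ! i)) = (\<Sum>i<length e. if i = k then e ! k else 0)"
    using k assms(1) by (intro sum.cong) (auto simp: orthonormal_def)
  with k show ?case by simp
qed

lemma hinner_orthonormal_sum:
  assumes "orthonormal e" "k < length e"
  shows "hinner (\<Sum>i<length e. scl (a i) (e ! i)) (e ! k) = a k"
proof -
  have "hinner (\<Sum>i<length e. scl (a i) (e ! i)) (e ! k) = (\<Sum>i<length e. if i = k then a k else 0)"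
    unfolding hinner_simps using assms by (intro sum.cong) (auto simp: orthonormal_def)
  with assms show ?thesis by simp
qed

lemma hnorm_orthonormal_sum:
  assumes "orthonormal e"
  shows "hnorm (\<Sum>i<length e. scl (a i) (e ! i)) = L2_set (\<lambda>i. norm (a i)) {..<length e}"
    (is "hnorm ?x = _")
proof -
  have "hinner ?x ?x = (\<Sum>k<length e. cjg (a k) * hinner ?x (e ! k))"
    unfolding hinner_sum_right hinner_scl_right ..
  also have "\<dots> = (\<Sum>k<length e. a k * cjg (a k))"
    using assms by (intro sum.cong) (simp_all add: hinner_orthonormal_sum mult.commute)
  also have "\<dots> = of_real (\<Sum>k<length e. (norm (a k))\<^sup>2)"
    by (simp add: mult_cjg)
  finally have "(hnorm ?x)\<^sup>2 = (\<Sum>k<length e. (norm (a k))\<^sup>2)"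
    unfolding hinner_self by (simp only: of_real_eq_iff)
  then show ?thesis
    by (simp add: L2_set_def real_sqrt_unique)
qed

lemma hnorm_orthonormal [simp]:
  assumes "orthonormal e" "x \<in> set e"
  shows "hnorm x = 1"
proof -
  have "hinner x x = 1"
    using assms by (auto simp: orthonormal_def in_set_conv_nth)
  then have "(hnorm x)\<^sup>2 = 1"
    unfolding hinner_self by (metis of_real_eq_1_iff)
  then show ?thesis by (simp add: power2_eq_1_iff) (use hnorm_nonneg[of x] in linarith)
qed

lemma orthonormal_distinct:
  assumes "orthonormal e"
  shows "distinct e"
  unfolding distinct_conv_nth
proof (intro allI impI)
  fix i j assume "i < length e" "j < length e" "i \<noteq> j"
  then have "hinner (e ! i) (e ! i) \<noteq> hinner (e ! i) (e ! j)"
    using assms by (simp add: orthonormal_def)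
  then show "e ! i \<noteq> e ! j" by metis
qed

lemma orthonormal_independent:
  assumes "orthonormal e"
  shows "fsp.independent (set e)"
proof
  assume "fsp.dependent (set e)"
  then obtain x where x: "x \<in> set e" "x \<in> fspan (set e - {x})"
    by (auto simp: fsp.dependent_def)
  have "hinner x x = 0"
    using x(2) by (rule hinner_span_0)
      (use x(1) assms in \<open>auto simp: orthonormal_def in_set_conv_nth\<close>)
  then show False
    using hnorm_orthonormal[OF assms x(1)] by (simp add: hinner_self)
qed

lemma fdim_orthonormal:
  assumes "orthonormal e"
  shows "fdim (fspan (set e)) = length e"
  using fsp.dim_span_eq_card_independent[OF orthonormal_independent[OF assms]]
    distinct_card[OF orthonormal_distinct[OF assms]]
  by simp

lemma orthonormal_basis_length: "orthonormal_basis e V \<Longrightarrow> length e = fdim V"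
  using fdim_orthonormal by (metis orthonormal_basis_iff)

lemma orthonormal_Cons:
  "orthonormal (x # e) \<longleftrightarrow> hnorm x = 1 \<and> (\<forall>y\<in>set e. hinner y x = 0) \<and> orthonormal e"
proof -
  have "hinner x x = 1 \<longleftrightarrow> hnorm x = 1"
    unfolding hinner_self using hnorm_nonneg[of x]
    by (metis of_real_eq_1_iff power2_eq_1_iff one_power2 not_one_le_zero neg_0_le_iff_le)
  then show ?thesis
    by (auto simp: orthonormal_def All_less_Suc2 all_set_conv_all_nth hinner_eq_0_commute[of x])
qed

lemma orthonormal_take: "orthonormal e \<Longrightarrow> orthonormal (take n e)"
  by (simp add: orthonormal_def)

lemma orthonormal_drop: "orthonormal e \<Longrightarrow> orthonormal (drop n e)"
  by (simp add: orthonormal_def)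

text \<open>
Gram-Schmidt: a new spanning vector is replaced by its component orthogonal to the basis found so
far, and dropped if that component vanishes.
\<close>

lemma orthonormal_basis_exists:
  assumes "finite B"
  shows "\<exists>e. orthonormal_basis e (fspan B)"
  using assms
proof (induction B)
  case empty
  show ?case by (auto simp: orthonormal_basis_iff orthonormal_def intro!: exI[of _ "[]"])
next
  case (insert b B)
  then obtain e where e: "orthonormal e" "fspan (set e) = fspan B"
    by (auto simp: orthonormal_basis_iff)
  define r where "r = (\<Sum>i<length e. scl (hinner b (e ! i)) (e ! i))"
  define u where "u = b - r"
  have r: "r \<in> fspan (set e)"
    unfolding r_def by (intro fsp.span_sum fsp.span_scale fsp.span_base) auto
  have orth: "hinner u y = 0" if y: "y \<in> set e" for y
    using that e(1)
    by (auto simp: u_def r_def hinner_diff_left in_set_conv_nth hinner_orthonormal_sum)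
  have sp: "fspan (insert b B) = fspan (insert u (set e))"
  proof -
    have "fspan (insert b B) = fspan (insert b (set e))"
      by (simp only: fsp.span_insert e(2))
    also have "\<dots> = fspan (insert u (set e))"
      by (rule fsp.eq_span_insert_eq) (simp add: u_def r)
    finally show ?thesis .
  qed
  show ?case
  proof (cases "u = 0")
    case True
    then show ?thesis using sp e fsp.span_insert_0 by (auto simp: orthonormal_basis_iff)
  next
    case False
    define v where "v = scl (of_real (1 / hnorm u)) u"
    have v: "hnorm v = 1" using False by (simp add: v_def hnorm_scl norm_divide)
    have u: "u = scl (of_real (hnorm u)) v" 
      using False by (simp add: v_def flip: of_real_mult)
    have "orthonormal (v # e)"
      using v e(1) orth by (auto simp: orthonormal_Cons v_def hinner_simps hinner_eq_0_commute[of _ u])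
    moreover have "fspan (set (v # e)) = fspan (insert u (set e))"
    proof -
      have "u \<in> fspan (insert v (set e))"
        by (subst u) (intro fsp.span_scale fsp.span_base; simp)
      moreover have "v \<in> fspan (insert u (set e))"
        unfolding v_def by (intro fsp.span_scale fsp.span_base) simp
      ultimately show ?thesis
        by (auto simp: fsp.span_eq intro: fsp.span_base)
    qed
    ultimately show ?thesis using sp by (metis orthonormal_basis_iff)
  qed
qed

section \<open>Existence of principal angles\<close>

lemma continuous_on_cjg [continuous_intros]:
  assumes "continuous_on A g"
  shows "continuous_on A (\<lambda>x. cjg (g x :: 'a :: real_or_complex))"
proof -
  have "dist (cjg x) (cjg y) = dist x y" for x y :: 'a
    by (metis cjg_add cjg_minus dist_norm norm_cjg uminus_add_conv_diff add.commute)
  then have "continuous_on UNIV (cjg :: 'a \<Rightarrow> 'a)"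
    by (auto simp: continuous_on_iff)
  then show ?thesis
    using assms continuous_on_compose2 by blast
qed

text \<open>
The unit sphere of \<open>\<F>\<^sup>p\<close> for a variable \<open>p\<close>, as a set of functions on \<open>nat\<close> that vanish from \<open>p\<close>
on.  It is compact in the product topology, and an orthonormal basis parametrises the unit sphere of
a \<open>p\<close>-dimensional subspace by it, so that maxima over that sphere are attained.
\<close>

definition unit_coeffs :: "nat \<Rightarrow> (nat \<Rightarrow> 'a :: real_or_complex) set" where
  "unit_coeffs p = {x. (\<forall>i\<ge>p. x i = 0) \<and> L2_set (\<lambda>i. norm (x i)) {..<p} = 1}"

lemma compact_unit_coeffs: "compact (unit_coeffs p :: (nat \<Rightarrow> 'a :: real_or_complex) set)"
proof -
  define S where "S i = (if i < p then cball 0 1 else {0 :: 'a})" for i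
  have "compactin (product_topology (\<lambda>_. euclidean) UNIV) (PiE UNIV S)"
    unfolding compactin_PiE by (auto simp: S_def)
  then have "compact (PiE UNIV S)"
    by (simp add: euclidean_product_topology)
  moreover have "closed {x :: nat \<Rightarrow> 'a. L2_set (\<lambda>i. norm (x i)) {..<p} = 1}"
    unfolding L2_set_def
    by (intro closed_Collect_eq continuous_intros continuous_on_product_coordinates)
  moreover have "unit_coeffs p = PiE UNIV S \<inter> {x. L2_set (\<lambda>i. norm (x i)) {..<p} = 1}"
  proof -
    have "norm (x i) \<le> 1" if "L2_set (\<lambda>i. norm (x i)) {..<p} = 1" "i < p" for x :: "nat \<Rightarrow> 'a" and i
      using member_le_L2_set[of "{..<p}" i "\<lambda>i. norm (x i)"] that by simp
    then show ?thesis
      by (auto simp: unit_coeffs_def S_def PiE_def Pi_def split: if_splits)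
  qed
  ultimately show ?thesis
    by (simp add: compact_Int_closed)
qed

lemma unit_vector_coeffs:
  assumes "orthonormal e" "x \<in> fspan (set e)" "hnorm x = 1"
  obtains a where "a \<in> unit_coeffs (length e)" "x = (\<Sum>i<length e. scl (a i) (e ! i))"
proof -
  define a where "a i = (if i < length e then hinner x (e ! i) else 0)" for i
  have x: "x = (\<Sum>i<length e. scl (a i) (e ! i))"
    using orthonormal_expansion[OF assms(1,2)] by (simp add: a_def)
  then have "a \<in> unit_coeffs (length e)"
    using hnorm_orthonormal_sum[OF assms(1), of a] assms(3)
    by (simp add: unit_coeffs_def a_def)
  with x that show ?thesis by blast
qed

text \<open>
The first singular value with its pair of singular vectors: \<open>\<bar>\<langle>v, w\<rangle>\<bar>\<close> attains its maximum \<open>c\<close> over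
the two unit spheres by compactness, and multiplying \<open>v\<close> by a scalar of modulus one makes the
maximal pairing equal to \<open>c\<close>.
\<close>

lemma maximal_pairing:
  assumes a: "orthonormal a" "a \<noteq> []" and b: "orthonormal b" "b \<noteq> []"
  obtains v w c where
    "v \<in> fspan (set a)" "hnorm v = 1" "w \<in> fspan (set b)" "hnorm w = 1"
    "0 \<le> c" "hinner v w = of_real c"
    "\<And>x y. x \<in> fspan (set a) \<Longrightarrow> y \<in> fspan (set b) \<Longrightarrow> norm (hinner x y) \<le> c * (hnorm x * hnorm y)"
proof -
  define comb :: "'a fseq list \<Rightarrow> (nat \<Rightarrow> 'a) \<Rightarrow> 'a fseq"
    where "comb e s = (\<Sum>i<length e. scl (s i) (e ! i))" for e s
  define K :: "((nat \<Rightarrow> 'a) \<times> (nat \<Rightarrow> 'a)) set"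
    where "K = unit_coeffs (length a) \<times> unit_coeffs (length b)"
  define \<phi> where "\<phi> st = norm (hinner (comb a (fst st)) (comb b (snd st)))" for st
  have comb_span: "comb e s \<in> fspan (set e)" for e s
    unfolding comb_def by (intro fsp.span_sum fsp.span_scale fsp.span_base) auto
  have comb_norm: "hnorm (comb e s) = 1" if "orthonormal e" "s \<in> unit_coeffs (length e)" for e s
    unfolding comb_def using that by (simp add: hnorm_orthonormal_sum unit_coeffs_def)
  have ne: "unit_coeffs (length e) \<noteq> ({} :: (nat \<Rightarrow> 'a) set)" if e: "orthonormal e" "e \<noteq> []" for e :: "'a fseq list"
  proof -
    have "hd e \<in> fspan (set e)" "hnorm (hd e) = 1"
      using e by (auto intro: fsp.span_base)
    then obtain a where a: "a \<in> unit_coeffs (length e)" "hd e = (\<Sum>i<length e. scl (a i) (e ! i))"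
      by (rule unit_vector_coeffs[OF e(1)])
    from a(1) show ?thesis by blast
  qed
  have "compact K"
    unfolding K_def by (rule compact_Times[OF compact_unit_coeffs compact_unit_coeffs])
  moreover have "K \<noteq> {}"
    using ne a b by (auto simp: K_def)
  moreover have "continuous_on K \<phi>"
  proof -
    have "continuous_on K (\<lambda>st. fst st i)" "continuous_on K (\<lambda>st. snd st i)" for i
      by (rule continuous_on_product_then_coordinatewise; intro continuous_intros)+
    then show ?thesis
      unfolding \<phi>_def comb_def hinner_simps by (intro continuous_intros)
  qed
  ultimately obtain s t where st: "(s, t) \<in> K" "\<And>z. z \<in> K \<Longrightarrow> \<phi> z \<le> \<phi> (s, t)"
    using continuous_attains_sup[of K \<phi>] by auto
  define c where "c = \<phi> (s, t)"
  define h where "h = hinner (comb a s) (comb b t)"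
  \<comment> \<open>the phase that rotates the pairing \<open>h\<close> onto the nonnegative real axis\<close>
  define u where "u = (if h = 0 then 1 else of_real c / h)"
  have c: "c = norm h" by (simp add: c_def \<phi>_def h_def)
  have u: "norm u = 1" "u * h = of_real c" by (simp_all add: u_def c norm_divide)
  have max1: "norm (hinner x y) \<le> c"
    if x: "x \<in> fspan (set a)" "hnorm x = 1" and y: "y \<in> fspan (set b)" "hnorm y = 1" for x y
  proof -
    obtain s' where "s' \<in> unit_coeffs (length a)" "x = comb a s'"
      using unit_vector_coeffs[OF a(1) x] unfolding comb_def by blast
    moreover obtain t' where "t' \<in> unit_coeffs (length b)" "y = comb b t'"
      using unit_vector_coeffs[OF b(1) y] unfolding comb_def by blast
    ultimately show ?thesis
      using st(2)[of "(s', t')"] by (simp add: K_def \<phi>_def c_def)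
  qed
  have max: "norm (hinner x y) \<le> c * (hnorm x * hnorm y)"
    if x: "x \<in> fspan (set a)" and y: "y \<in> fspan (set b)" for x y
  proof (cases "x = 0 \<or> y = 0")
    case False
    define n where "n z = scl (of_real (1 / hnorm z)) z" for z :: "'a fseq"
    have n: "hnorm (n z) = 1" if "z \<noteq> 0" for z
      using that by (simp add: n_def hnorm_scl norm_divide)
    have "norm (hinner (n x) (n y)) \<le> c"
      using x y False n by (intro max1) (auto simp: n_def intro: fsp.span_scale)
    then show ?thesis
      using False unfolding n_def hinner_simps norm_mult norm_cjg norm_of_real
      by (simp add: field_simps order_less_le)
  qed (auto simp: c)
  show thesis
  proof (rule that[of "scl u (comb a s)" "comb b t" c])
    show "scl u (comb a s) \<in> fspan (set a)" "comb b t \<in> fspan (set b)"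
      by (simp_all add: comb_span fsp.span_scale)
    show "hnorm (scl u (comb a s)) = 1" "hnorm (comb b t) = 1"
      using comb_norm a b st(1) by (simp_all add: hnorm_scl u K_def)
    show "hinner (scl u (comb a s)) (comb b t) = of_real c"
      using u(2) by (simp add: hinner_scl_left h_def)
    show "0 \<le> c" by (simp add: c)
  qed (rule max)
qed

text \<open>
First-order condition at the maximum.  If \<open>x\<close> is a unit vector orthogonal to \<open>v\<close> with
\<open>\<langle>x, w\<rangle> = b\<close>, then \<open>c v + cjg b x\<close> pairs with \<open>w\<close> to \<open>c\<^sup>2 + \<bar>b\<bar>\<^sup>2\<close>, while its norm is
\<open>\<surd>(c\<^sup>2 + \<bar>b\<bar>\<^sup>2)\<close>; maximality of \<open>c\<close> therefore forces \<open>b = 0\<close>.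
\<close>

lemma maximal_pairing_orthogonal:
  assumes V: "fsubspace V" "v \<in> V" "hnorm v = 1" and c: "0 \<le> c" "hinner v w = of_real c"
    and bound: "\<And>z. z \<in> V \<Longrightarrow> norm (hinner z w) \<le> c * hnorm z"
    and x: "x \<in> V" "hinner x v = 0"
  shows "hinner x w = 0"
proof (rule ccontr)
  assume neq: "hinner x w \<noteq> 0"
  define N where "N = (hnorm x)\<^sup>2"
  define B where "B = (norm (hinner x w))\<^sup>2"
  \<comment> \<open>homogenised form of the test vector: \<open>x\<close> need not be normalised\<close>
  define z where "z = scl (of_real (c * N)) v + scl (cjg (hinner x w)) x"
  have "z \<in> V"
    unfolding z_def using V x by (intro fsp.subspace_add fsp.subspace_scale)
  have "B > 0" using neq by (simp add: B_def)
  have "hinner v v = 1" "hinner x x = of_real N" "hinner v x = 0"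
    using V(3) x(2) by (simp_all add: hinner_self N_def hinner_eq_0_commute[of v])
  then have zz: "hinner z z = of_real (c\<^sup>2 * N\<^sup>2 + B * N)"
    unfolding z_def hinner_simps
    using mult_cjg[of "hinner x w"] x(2) cjg_of_real[of "c * N", where 'a = 'a]
    by (simp add: B_def power2_eq_square algebra_simps)
  have "hinner z w = of_real (c\<^sup>2 * N + B)"
    unfolding z_def hinner_simps c
    using mult_cjg[of "hinner x w"]
    by (simp add: B_def power2_eq_square algebra_simps)
  moreover have "0 \<le> c\<^sup>2 * N" by (simp add: N_def)
  ultimately have le: "c\<^sup>2 * N + B \<le> c * hnorm z"
    using bound[OF \<open>z \<in> V\<close>] \<open>B > 0\<close> by (metis norm_of_real abs_of_nonneg add_nonneg_nonneg less_imp_le)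
  have hz: "(hnorm z)\<^sup>2 = c\<^sup>2 * N\<^sup>2 + B * N"
    using zz unfolding hinner_self by (simp only: of_real_eq_iff)
  have "(c\<^sup>2 * N + B)\<^sup>2 \<le> (c * hnorm z)\<^sup>2"
    using le \<open>0 \<le> c\<^sup>2 * N\<close> \<open>B > 0\<close> by (intro power_mono) auto
  also have "\<dots> = c\<^sup>2 * N * (c\<^sup>2 * N + B)"
    unfolding power_mult_distrib hz by (simp add: power2_eq_square algebra_simps)
  finally have "B * (c\<^sup>2 * N + B) \<le> 0"
    by (simp add: power2_eq_square algebra_simps)
  moreover have "B * (c\<^sup>2 * N + B) > 0"
    using \<open>0 \<le> c\<^sup>2 * N\<close> \<open>B > 0\<close> by (intro mult_pos_pos) auto
  ultimately show False by simp
qed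

text \<open>
The projections of \<open>e\<close> to the orthogonal complement of \<open>v\<close> span that complement, and any orthonormal
basis of it is completed by \<open>v\<close>.
\<close>

lemma orthonormal_basis_through:
  assumes "orthonormal e" "v \<in> fspan (set e)" "hnorm v = 1"
  obtains e0 where "orthonormal_basis (v # e0) (fspan (set e))"
proof -
  define B where "B = (\<lambda>x. x - scl (hinner x v) v) ` set e"
  obtain e0 where e0: "orthonormal e0" "fspan (set e0) = fspan B"
    using orthonormal_basis_exists[of B] by (auto simp: B_def orthonormal_basis_iff)
  have vv: "hinner v v = 1" using assms(3) by (simp add: hinner_self)
  have "hinner y v = 0" if "y \<in> set e0" for y
  proof (rule hinner_span_0)
    show "y \<in> fspan B" using that e0(2) fsp.span_base by blast
  qed (auto simp: B_def hinner_simps vv)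
  then have "orthonormal (v # e0)"
    using e0(1) assms(3) by (simp add: orthonormal_Cons)
  moreover have "fspan (set (v # e0)) = fspan (set e)"
  proof -
    have "fspan (set (v # e0)) = fspan (insert v B)"
      using e0(2) by (simp only: list.set fsp.span_insert)
    also have "\<dots> = fspan (set e)"
      unfolding fsp.span_eq
    proof safe
      show "v \<in> fspan (set e)" by fact
      fix y assume "y \<in> B"
      then show "y \<in> fspan (set e)"
        using assms(2) by (auto simp: B_def intro!: fsp.span_diff fsp.span_scale intro: fsp.span_base)
    next
      fix y assume y: "y \<in> set e"
      have "y = (y - scl (hinner y v) v) + scl (hinner y v) v" by simp
      also have "\<dots> \<in> fspan (insert v B)"
        using y by (intro fsp.span_add fsp.span_scale fsp.span_base) (auto simp: B_def)
      finally show "y \<in> fspan (insert v B)" .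
    qed
    finally show ?thesis .
  qed
  ultimately show ?thesis
    using that by (simp add: orthonormal_basis_iff)
qed

text \<open>
Splitting off the first singular pair \<open>v\<close>, \<open>w\<close>: by the first-order condition the pairing vanishes
between \<open>v\<close> and the rest of \<open>W\<close> and between \<open>w\<close> and the rest of \<open>V\<close>, so that principal bases of the
orthogonal complements are completed by \<open>v\<close> and \<open>w\<close>.  The new angle comes first in the list because
every cosine in \<open>\<theta>\<close> is a pairing of unit vectors and hence at most \<open>c\<close>.
\<close>

lemma principal_angles_Cons:
  assumes v: "orthonormal_basis (v # e0) V" and w: "orthonormal_basis (w # f0) W"
    and c: "0 \<le> c" "hinner v w = of_real c"
    and max: "\<And>x y. x \<in> V \<Longrightarrow> y \<in> W \<Longrightarrow> norm (hinner x y) \<le> c * (hnorm x * hnorm y)"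
    and \<theta>: "principal_angles (fspan (set e0)) (fspan (set f0)) \<theta>"
  shows "principal_angles V W (arccos c # \<theta>)"
proof -
  let ?V0 = "fspan (set e0)" and ?W0 = "fspan (set f0)"
  obtain e f where ef: "orthonormal_basis e ?V0" "orthonormal_basis f ?W0"
     "\<And>i j. i < length e \<Longrightarrow> j < length f \<Longrightarrow> i \<noteq> j \<Longrightarrow> hinner (e ! i) (f ! j) = 0"
     "\<And>i. i < min (fdim ?V0) (fdim ?W0) \<Longrightarrow> hinner (e ! i) (f ! i) = of_real (cos (\<theta> ! i))"
    and tup: "angle_tuple (min (fdim ?V0) (fdim ?W0)) \<theta>"
    using \<theta> unfolding principal_angles_def by blast
  have ext: "orthonormal_basis (u # g) U"
    if "orthonormal_basis (u # g0) U" "orthonormal_basis g (fspan (set g0))"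
    for u g g0 and U :: "'a fseq set"
  proof -
    have "hinner y u = 0" if "y \<in> set g" for y
      using that \<open>orthonormal_basis (u # g0) U\<close> \<open>orthonormal_basis g (fspan (set g0))\<close>
      by (intro hinner_span_0[of y "set g0"])
        (auto simp: orthonormal_basis_iff orthonormal_Cons intro: fsp.span_base)
    moreover have "fspan (set (u # g)) = U"
      using that by (simp only: orthonormal_basis_iff list.set fsp.span_insert)
    ultimately show ?thesis
      using that by (simp add: orthonormal_basis_iff orthonormal_Cons)
  qed
  have e: "orthonormal_basis (v # e) V" and f: "orthonormal_basis (w # f) W"
    using ext v w ef by blast+
  have V: "fsubspace V" and W: "fsubspace W"
    using v w by (auto simp: orthonormal_basis_iff intro: fsp.subspace_span)
  have in_V: "x \<in> V" if "x \<in> set (v # e)" for x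
    using e that by (metis orthonormal_basis_iff fsp.span_base)
  have in_W: "x \<in> W" if "x \<in> set (w # f)" for x
    using f that by (metis orthonormal_basis_iff fsp.span_base)
  have on: "hnorm x = 1" if "x \<in> set (v # e) \<or> x \<in> set (w # f)" for x
    using that e f hnorm_orthonormal by (metis orthonormal_basis_iff)
  have dims: "fdim V = Suc (length e)" "fdim W = Suc (length f)"
     "fdim ?V0 = length e" "fdim ?W0 = length f"
    using orthonormal_basis_length e f ef(1,2) by (metis length_Cons)+
  have diag: "hinner (e ! i) (f ! i) = of_real (cos (\<theta> ! i))"
    if "i < min (length e) (length f)" for i
    using ef(4)[of i] that unfolding dims .
  have ev: "hinner x v = 0" if "x \<in> set e" for x
    using e that by (auto simp: orthonormal_basis_iff orthonormal_Cons)
  have fw: "hinner x w = 0" if "x \<in> set f" for x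
    using f that by (auto simp: orthonormal_basis_iff orthonormal_Cons)
  have ew: "hinner x w = 0" if "x \<in> set e" for x
  proof (rule maximal_pairing_orthogonal[OF V _ _ c])
    show "norm (hinner z w) \<le> c * hnorm z" if "z \<in> V" for z
      using max[OF that in_W, of w] on[of w] by simp
  qed (use that in_V on ev in auto)
  have fv: "hinner v x = 0" if "x \<in> set f" for x
    unfolding hinner_eq_0_commute[of v]
  proof (rule maximal_pairing_orthogonal[OF W _ _ c(1)])
    show "hinner w v = of_real c"
      using c(2) by (metis hinner_commute cjg_of_real)
    show "norm (hinner z v) \<le> c * hnorm z" if "z \<in> W" for z
      using max[OF in_V that, of v] on[of v] by (simp add: hinner_commute[of z])
  qed (use that in_W on fw in auto)
  have "c \<le> 1"
    using hinner_Cauchy_Schwarz[of v w] c on[of v] on[of w] by simp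
  have len: "length \<theta> = min (length e) (length f)" "sorted \<theta>" "set \<theta> \<subseteq> {0..pi/2}"
    using tup unfolding angle_tuple_def dims by simp_all
  have "arccos c \<le> t" if t_in: "t \<in> set \<theta>" for t
  proof -
    obtain i where i: "i < length \<theta>" "t = \<theta> ! i"
      using t_in by (auto simp: in_set_conv_nth)
    have t: "0 \<le> t" "t \<le> pi / 2" using that len(3) by auto
    then have "0 \<le> cos t" by (intro cos_ge_zero) auto
    have "norm (hinner (e ! i) (f ! i)) \<le> c"
      using max[of "e ! i" "f ! i"] in_V[of "e ! i"] in_W[of "f ! i"] on[of "e ! i"] on[of "f ! i"] i len(1)
      by simp
    moreover have "hinner (e ! i) (f ! i) = of_real (cos t)"
      using diag[of i] i len(1) by simp
    ultimately have "cos t \<le> c" using \<open>0 \<le> cos t\<close> by simp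
    then have "arccos c \<le> arccos (cos t)"
      using \<open>c \<le> 1\<close> by (intro arccos_le_arccos) auto
    then show ?thesis using t by (simp add: arccos_cos)
  qed
  moreover have "0 \<le> arccos c" "arccos c \<le> pi / 2"
    using c(1) \<open>c \<le> 1\<close> arccos_lbound[of c] arccos_le_pi2[of c] by linarith+
  ultimately have "angle_tuple (min (fdim V) (fdim W)) (arccos c # \<theta>)"
    using len by (simp add: angle_tuple_def dims)
  moreover have "hinner ((v # e) ! i) ((w # f) ! j) = 0"
    if "i < length (v # e)" "j < length (w # f)" "i \<noteq> j" for i j
    using that ef(3) ew fv by (auto simp: nth_Cons split: nat.splits)
  moreover have "hinner ((v # e) ! i) ((w # f) ! i) = of_real (cos ((arccos c # \<theta>) ! i))"
    if "i < min (fdim V) (fdim W)" for i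
    using that diag c \<open>c \<le> 1\<close> by (auto simp: nth_Cons dims split: nat.splits)
  ultimately show ?thesis
    unfolding principal_angles_def using e f by blast
qed

lemma principal_angles_Nil:
  assumes "orthonormal a" "orthonormal b" "a = [] \<or> b = []"
  shows "principal_angles (fspan (set a)) (fspan (set b)) []"
proof -
  have "min (fdim (fspan (set a))) (fdim (fspan (set b))) = 0"
    using assms by (metis fdim_orthonormal list.size(3) min_0L min_0R)
  moreover have "orthonormal_basis a (fspan (set a))" "orthonormal_basis b (fspan (set b))"
    using assms by (simp_all add: orthonormal_basis_iff)
  moreover have "\<forall>i<length a. \<forall>j<length b. i \<noteq> j \<longrightarrow> hinner (a ! i) (b ! j) = 0"
    using assms(3) by auto
  ultimately show ?thesis
    unfolding principal_angles_def angle_tuple_def by auto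
qed

lemma principal_angles_exist:
  assumes "orthonormal a" "orthonormal b"
  shows "\<exists>\<theta>. principal_angles (fspan (set a)) (fspan (set b)) \<theta>"
  using assms
proof (induction "length a" arbitrary: a b)
  case 0
  then show ?case
    by (intro exI[of _ "[]"] principal_angles_Nil) auto
next
  case (Suc n)
  show ?case
  proof (cases "b = []")
    case True
    then show ?thesis using Suc.prems
      by (intro exI[of _ "[]"] principal_angles_Nil) auto
  next
    case False
    have "a \<noteq> []" using Suc.hyps(2) by auto
    with False obtain v w c where vw:
      "v \<in> fspan (set a)" "hnorm v = 1" "w \<in> fspan (set b)" "hnorm w = 1"
      "0 \<le> c" "hinner v w = of_real c"
      "\<And>x y. x \<in> fspan (set a) \<Longrightarrow> y \<in> fspan (set b) \<Longrightarrow> norm (hinner x y) \<le> c * (hnorm x * hnorm y)"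
      using maximal_pairing[OF Suc.prems(1) _ Suc.prems(2)] by metis
    obtain e0 where e0: "orthonormal_basis (v # e0) (fspan (set a))"
      using orthonormal_basis_through[OF Suc.prems(1) vw(1,2)] .
    obtain f0 where f0: "orthonormal_basis (w # f0) (fspan (set b))"
      using orthonormal_basis_through[OF Suc.prems(2) vw(3,4)] .
    have "length (v # e0) = length a"
      using orthonormal_basis_length[OF e0] fdim_orthonormal[OF Suc.prems(1)] by metis
    then have "n = length e0" using Suc.hyps(2) by simp
    moreover have "orthonormal e0" "orthonormal f0"
      using e0 f0 by (auto simp: orthonormal_basis_iff orthonormal_Cons)
    ultimately obtain \<theta> where "principal_angles (fspan (set e0)) (fspan (set f0)) \<theta>"
      using Suc.hyps(1) by metis
    then show ?thesis
      using principal_angles_Cons[OF e0 f0 vw(5,6,7)] by blast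
  qed
qed

section \<open>Interlacing of principal angles\<close>

text \<open>
The pairs of bases that witness principal angles, with both conditions on the pairings merged.
Dimensions appear as lengths of lists.
\<close>

definition principal_bases ::
    "('a :: real_or_complex) fseq list \<Rightarrow> 'a fseq list \<Rightarrow> real list \<Rightarrow> bool" where
  "principal_bases e f \<theta> \<longleftrightarrow> orthonormal e \<and> orthonormal f \<and>
     angle_tuple (min (length e) (length f)) \<theta> \<and>
     (\<forall>i < length e. \<forall>j < length f.
        hinner (e ! i) (f ! j) = (if i = j then of_real (cos (\<theta> ! i)) else 0))"

lemma principal_angles_iff:
  "principal_angles V W \<theta> \<longleftrightarrow>
     (\<exists>e f. principal_bases e f \<theta> \<and> fspan (set e) = V \<and> fspan (set f) = W)"
proof
  assume "principal_angles V W \<theta>"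
  then obtain e f where *: "orthonormal_basis e V" "orthonormal_basis f W"
    "angle_tuple (min (fdim V) (fdim W)) \<theta>"
    "\<forall>i < length e. \<forall>j < length f. i \<noteq> j \<longrightarrow> hinner (e ! i) (f ! j) = 0"
    "\<forall>i < min (fdim V) (fdim W). hinner (e ! i) (f ! i) = of_real (cos (\<theta> ! i))"
    unfolding principal_angles_def by blast
  then show "\<exists>e f. principal_bases e f \<theta> \<and> fspan (set e) = V \<and> fspan (set f) = W"
    by (intro exI[of _ e] exI[of _ f])
      (auto simp: principal_bases_def orthonormal_basis_iff orthonormal_basis_length[OF *(1), symmetric]
         orthonormal_basis_length[OF *(2), symmetric])
next
  assume "\<exists>e f. principal_bases e f \<theta> \<and> fspan (set e) = V \<and> fspan (set f) = W"
  then obtain e f where *: "principal_bases e f \<theta>" "fspan (set e) = V" "fspan (set f) = W"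
    by blast
  then have "orthonormal_basis e V" "orthonormal_basis f W"
    by (auto simp: principal_bases_def orthonormal_basis_iff)
  moreover from this have "fdim V = length e" "fdim W = length f"
    by (simp_all add: orthonormal_basis_length)
  ultimately show "principal_angles V W \<theta>"
    using *(1) unfolding principal_angles_def principal_bases_def
    by (intro conjI exI[of _ e] exI[of _ f]) auto
qed

lemma hinner_principal_bases:
  assumes pb: "principal_bases e f \<theta>" and x: "x \<in> fspan (set e)" and y: "y \<in> fspan (set f)"
  shows "hinner x y = (\<Sum>i<min (length e) (length f).
           hinner x (e ! i) * cjg (hinner y (f ! i)) * of_real (cos (\<theta> ! i)))"
proof -
  define a where "a i = hinner x (e ! i)" for i
  define b where "b j = hinner y (f ! j)" for j
  have x: "x = (\<Sum>i<length e. scl (a i) (e ! i))" and y: "y = (\<Sum>j<length f. scl (b j) (f ! j))"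
    using pb x y orthonormal_expansion unfolding a_def b_def principal_bases_def by blast+
  have "hinner x y = (\<Sum>j<length f. cjg (b j) * (\<Sum>i<length e. a i * hinner (e ! i) (f ! j)))"
    by (subst x, subst y) (simp only: hinner_sum_right hinner_scl_right hinner_sum_left hinner_scl_left)
  also have "\<dots> = (\<Sum>j<length f. if j < length e then a j * cjg (b j) * of_real (cos (\<theta> ! j)) else 0)"
  proof (intro sum.cong refl)
    fix j assume "j \<in> {..<length f}"
    then have "(\<Sum>i<length e. a i * hinner (e ! i) (f ! j)) =
          (\<Sum>i<length e. if i = j then a j * of_real (cos (\<theta> ! j)) else 0)"
      using pb by (intro sum.cong) (auto simp: principal_bases_def)
    then show "cjg (b j) * (\<Sum>i<length e. a i * hinner (e ! i) (f ! j)) =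
       (if j < length e then a j * cjg (b j) * of_real (cos (\<theta> ! j)) else 0)"
      by simp
  qed
  also have "\<dots> = (\<Sum>j\<in>{j\<in>{..<length f}. j < length e}. a j * cjg (b j) * of_real (cos (\<theta> ! j)))"
    by (rule sum.inter_filter[symmetric]) simp
  also have "{j\<in>{..<length f}. j < length e} = {..<min (length e) (length f)}"
    by auto
  finally show ?thesis by (simp only: a_def b_def)
qed

text \<open>
A homogeneous linear system with fewer equations than unknowns has a nonzero solution.  Here this
is read off from principal bases: a principal vector of the larger space without a partner in the
smaller one is orthogonal to all of the smaller space.
\<close>

lemma orthogonal_unit_vector_exists:
  assumes "orthonormal a" "orthonormal b" "length b < length a"
  obtains x where "x \<in> fspan (set a)" "hnorm x = 1" "\<forall>y\<in>set b. hinner x y = 0"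
proof -
  obtain \<theta> e f where ef: "principal_bases e f \<theta>" "fspan (set e) = fspan (set a)"
      "fspan (set f) = fspan (set b)"
    using principal_angles_exist[OF assms(1,2)] unfolding principal_angles_iff by blast
  then have on: "orthonormal e" "orthonormal f" by (auto simp: principal_bases_def)
  then have len: "length e = length a" "length f = length b"
    using assms ef(2,3) by (metis fdim_orthonormal)+
  let ?x = "e ! length b"
  have "?x \<in> set e" using assms(3) len by simp
  moreover have "hinner ?x y = 0" if "y \<in> set b" for y
  proof -
    have "y \<in> fspan (set f)" using that ef(3) by (metis fsp.span_base)
    then have "hinner y ?x = 0"
    proof (rule hinner_span_0)
      fix s assume "s \<in> set f"
      then have "hinner ?x s = 0"
        using ef(1) len assms(3) by (auto simp: principal_bases_def in_set_conv_nth)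
      then show "hinner s ?x = 0" by (simp add: hinner_eq_0_commute)
    qed
    then show ?thesis by (simp add: hinner_eq_0_commute)
  qed
  ultimately show thesis
    using that[of ?x] on ef(2) by (metis fsp.span_base hnorm_orthonormal)
qed

lemma hnorm_expansion:
  assumes "orthonormal e" "x \<in> fspan (set e)"
  shows "L2_set (\<lambda>i. norm (hinner x (e ! i))) {..<length e} = hnorm x"
  using hnorm_orthonormal_sum[OF assms(1), of "\<lambda>i. hinner x (e ! i)"]
    orthonormal_expansion[OF assms] by metis

text \<open>
On the span of the first \<open>m + 1\<close> principal vectors the projection to the other space shrinks lengths
at most by the factor \<open>cos \<theta>\<^sub>m\<close>.  The witness \<open>y\<close> has the same coefficients as \<open>x\<close>, with every
principal vector replaced by its partner.
\<close>

lemma principal_pairing_lower: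
  assumes pb: "principal_bases e f \<theta>" and len: "length e = length f"
    and x: "x \<in> fspan (set e)" "hnorm x = 1" and m: "m < length e"
    and orth: "\<And>j. m < j \<Longrightarrow> j < length e \<Longrightarrow> hinner x (e ! j) = 0"
  obtains y where "y \<in> fspan (set f)" "hnorm y = 1" "cos (\<theta> ! m) \<le> norm (hinner x y)"
proof -
  define a where "a i = hinner x (e ! i)" for i
  define y where "y = (\<Sum>i<length f. scl (a i) (f ! i))"
  have on: "orthonormal e" "orthonormal f" and tup: "angle_tuple (length e) \<theta>"
    using pb len by (auto simp: principal_bases_def)
  have L2: "L2_set (\<lambda>i. norm (a i)) {..<length e} = 1"
    using hnorm_expansion[OF on(1) x(1)] x(2) by (simp add: a_def)
  have y: "y \<in> fspan (set f)"
    unfolding y_def by (intro fsp.span_sum fsp.span_scale fsp.span_base) auto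
  have ny: "hnorm y = 1"
    unfolding y_def using on L2 len by (simp add: hnorm_orthonormal_sum)
  have "hinner x y = (\<Sum>i<length e. hinner x (e ! i) * cjg (hinner y (f ! i)) * of_real (cos (\<theta> ! i)))"
    using hinner_principal_bases[OF pb x(1) y] len by simp
  also have "\<dots> = (\<Sum>i<length e. of_real ((norm (a i))\<^sup>2 * cos (\<theta> ! i)))"
  proof (intro sum.cong refl)
    fix i assume "i \<in> {..<length e}"
    then have "hinner y (f ! i) = a i"
      unfolding y_def using on len by (simp add: hinner_orthonormal_sum)
    then show "hinner x (e ! i) * cjg (hinner y (f ! i)) * of_real (cos (\<theta> ! i)) =
       of_real ((norm (a i))\<^sup>2 * cos (\<theta> ! i))"
      using mult_cjg[of "a i"] by (simp add: a_def)
  qed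
  finally have xy: "hinner x y = of_real (\<Sum>i<length e. (norm (a i))\<^sup>2 * cos (\<theta> ! i))"
    by simp
  have "cos (\<theta> ! m) = (\<Sum>i<length e. (norm (a i))\<^sup>2 * cos (\<theta> ! m))"
    using L2 by (simp add: L2_set_def sum_distrib_right[symmetric])
  also have "\<dots> \<le> (\<Sum>i<length e. (norm (a i))\<^sup>2 * cos (\<theta> ! i))"
  proof (intro sum_mono)
    fix i assume i: "i \<in> {..<length e}"
    show "(norm (a i))\<^sup>2 * cos (\<theta> ! m) \<le> (norm (a i))\<^sup>2 * cos (\<theta> ! i)"
    proof (cases "m < i")
      case True
      then show ?thesis using orth i by (simp add: a_def)
    next
      case False
      have "\<theta> ! i \<in> {0..pi/2}" "\<theta> ! m \<in> {0..pi/2}"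
        using tup i m by (auto simp: angle_tuple_def subset_iff)
      moreover have "\<theta> ! i \<le> \<theta> ! m"
        using tup False m by (auto simp: angle_tuple_def intro: sorted_nth_mono)
      ultimately have "cos (\<theta> ! m) \<le> cos (\<theta> ! i)"
        by (intro cos_monotone_0_pi_le) auto
      then show ?thesis by (intro mult_left_mono) auto
    qed
  qed
  also have "\<dots> \<le> norm (hinner x y)"
    unfolding xy norm_of_real by simp
  finally show ?thesis using that y ny by blast
qed

text \<open>
On the span of the principal vectors from index \<open>k\<close> on, the projection to the other space shrinks
lengths at least by the factor \<open>cos \<theta>\<^sub>k\<close>.
\<close>

lemma principal_pairing_upper:
  assumes pb: "principal_bases e f \<theta>" and len: "length e \<le> length f"
    and x: "x \<in> fspan (set e)" and k: "k < length e"
    and orth: "\<And>i. i < k \<Longrightarrow> hinner x (e ! i) = 0"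
    and y: "y \<in> fspan (set f)"
  shows "norm (hinner x y) \<le> cos (\<theta> ! k) * (hnorm x * hnorm y)"
proof -
  have on: "orthonormal e" "orthonormal f" and tup: "angle_tuple (length e) \<theta>"
    using pb len by (auto simp: principal_bases_def min_def)
  have rng: "\<theta> ! i \<in> {0..pi/2}" if "i < length e" for i
    using tup that by (auto simp: angle_tuple_def subset_iff)
  let ?a = "\<lambda>i. norm (hinner x (e ! i))" and ?b = "\<lambda>i. norm (hinner y (f ! i))"
  have c: "0 \<le> cos (\<theta> ! i)" if "i < length e" for i
    using rng[OF that] by (intro cos_ge_zero) auto
  have "norm (hinner x y) \<le> (\<Sum>i<length e. ?a i * ?b i * cos (\<theta> ! i))"
    unfolding hinner_principal_bases[OF pb x y] min_absorb1[OF len]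
    by (intro sum_norm_le) (simp add: norm_mult c)
  also have "\<dots> \<le> (\<Sum>i<length e. ?a i * ?b i * cos (\<theta> ! k))"
  proof (intro sum_mono)
    fix i assume i: "i \<in> {..<length e}"
    show "?a i * ?b i * cos (\<theta> ! i) \<le> ?a i * ?b i * cos (\<theta> ! k)"
    proof (cases "i < k")
      case True
      then show ?thesis using orth by simp
    next
      case False
      have "\<theta> ! k \<le> \<theta> ! i"
        using tup False i by (auto simp: angle_tuple_def intro: sorted_nth_mono)
      then have "cos (\<theta> ! i) \<le> cos (\<theta> ! k)"
        using rng[of i] rng[of k] i k by (intro cos_monotone_0_pi_le) auto
      then show ?thesis by (intro mult_left_mono) auto
    qed
  qed
  also have "\<dots> = cos (\<theta> ! k) * (\<Sum>i<length e. \<bar>?a i\<bar> * \<bar>?b i\<bar>)"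
    by (simp add: sum_distrib_left mult_ac)
  also have "\<dots> \<le> cos (\<theta> ! k) * (L2_set ?a {..<length e} * L2_set ?b {..<length e})"
    using c[OF k] by (intro mult_left_mono L2_set_mult_ineq)
  also have "\<dots> \<le> cos (\<theta> ! k) * (L2_set ?a {..<length e} * L2_set ?b {..<length f})"
  proof -
    have "L2_set ?b {..<length e} \<le> L2_set ?b {..<length f}"
      unfolding L2_set_def using len by (intro real_sqrt_le_mono sum_mono2) auto
    then show ?thesis
      using c[OF k] by (intro mult_left_mono L2_set_nonneg)
  qed
  finally show ?thesis
    by (simp only: hnorm_expansion[OF on(1) x] hnorm_expansion[OF on(2) y])
qed

lemma fdim_mono_orthonormal:
  assumes "orthonormal a" "orthonormal b" "fspan (set a) \<subseteq> fspan (set b)"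
  shows "length a \<le> length b"
proof -
  have "set a \<subseteq> fspan (set b)" using assms(3) fsp.span_superset by blast
  then have "card (set a) \<le> card (set b)"
    using fsp.independent_span_bound[OF _ orthonormal_independent[OF assms(1)]] by blast
  then show ?thesis
    using assms by (simp add: distinct_card orthonormal_distinct)
qed

text \<open>
Interlacing in the style of Courant and Fischer.  Let \<open>p = dim V'\<close> and \<open>q = dim V\<close>.  The span of the
last \<open>p - k\<close> principal vectors of \<open>V'\<close> lies in \<open>V\<close>, and so contains a unit vector \<open>x\<close> orthogonal to
the last \<open>p - k - 1\<close> principal vectors of \<open>V\<close>, that is, to those of index greater than
\<open>m = q - p + k\<close>.  The length of the projection of \<open>x\<close> to \<open>W\<close> is at least \<open>cos \<theta>\<^sub>m\<close> on account of \<open>V\<close>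
and at most \<open>cos \<theta>'\<^sub>k\<close> on account of \<open>V'\<close>, whence \<open>\<theta>'\<^sub>k \<le> \<theta>\<^sub>m\<close>.
\<close>

lemma principal_angles_interlacing:
  assumes "principal_angles V W \<theta>" "principal_angles V' W \<theta>'"
    and sub: "V' \<subseteq> V" and dim: "fdim V = fdim W"
  shows "list_all2 (\<le>) (replicate (fdim V - fdim V') 0 @ \<theta>') \<theta>"
proof -
  obtain e f where ef: "principal_bases e f \<theta>" "fspan (set e) = V" "fspan (set f) = W"
    using assms(1) unfolding principal_angles_iff by blast
  obtain e' f' where ef': "principal_bases e' f' \<theta>'" "fspan (set e') = V'" "fspan (set f') = W"
    using assms(2) unfolding principal_angles_iff by blast
  have on: "orthonormal e" "orthonormal f" "orthonormal e'" "orthonormal f'"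
    using ef(1) ef'(1) by (auto simp: principal_bases_def)
  have lens: "fdim V = length e" "fdim W = length f" "fdim V' = length e'" "fdim W = length f'"
    using fdim_orthonormal ef(2,3) ef'(2,3) on by metis+
  have le: "length e' \<le> length e"
    using fdim_mono_orthonormal[OF on(3,1)] sub ef(2) ef'(2) by simp
  have tup: "angle_tuple (length e) \<theta>" and tup': "angle_tuple (length e') \<theta>'"
    using ef(1) ef'(1) lens dim le by (auto simp: principal_bases_def min_def)
  have shifted: "\<theta>' ! k \<le> \<theta> ! (length e - length e' + k)" if k: "k < length e'" for k
  proof -
    define m where "m = length e - length e' + k"
    have m: "m < length e" using k le by (simp add: m_def)
    obtain x where x: "x \<in> fspan (set (drop k e'))" "hnorm x = 1"
        "\<forall>y\<in>set (drop (Suc m) e). hinner x y = 0"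
    proof (rule orthogonal_unit_vector_exists)
      show "orthonormal (drop k e')" "orthonormal (drop (Suc m) e)"
        using on by (simp_all add: orthonormal_drop)
      show "length (drop (Suc m) e) < length (drop k e')"
        using k le by (simp add: m_def)
    qed
    have xV': "x \<in> fspan (set e')"
      using x(1) fsp.span_mono[OF set_drop_subset] by blast
    have xV: "x \<in> fspan (set e)"
      using xV' sub ef(2) ef'(2) by blast
    obtain y where y: "y \<in> fspan (set f)" "hnorm y = 1" "cos (\<theta> ! m) \<le> norm (hinner x y)"
    proof (rule principal_pairing_lower[OF ef(1) _ xV x(2) m])
      show "length e = length f" using lens dim by simp
      fix j assume "m < j" "j < length e"
      then have "e ! j \<in> set (drop (Suc m) e)"
        by (auto simp: in_set_conv_nth intro!: exI[of _ "j - Suc m"])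
      then show "hinner x (e ! j) = 0" using x(3) by blast
    qed
    have "norm (hinner x y) \<le> cos (\<theta>' ! k) * (hnorm x * hnorm y)"
    proof (rule principal_pairing_upper[OF ef'(1) _ xV' k])
      show "length e' \<le> length f'" using lens dim le by simp
      show "y \<in> fspan (set f')" using y(1) ef(3) ef'(3) by simp
      fix i assume i: "i < k"
      show "hinner x (e' ! i) = 0"
      proof (rule hinner_span_0[OF x(1)])
        fix s assume "s \<in> set (drop k e')"
        then obtain j where "k \<le> j" "j < length e'" "s = e' ! j"
          by (auto simp: in_set_conv_nth) (metis le_add1 less_diff_conv add.commute)
        then show "hinner s (e' ! i) = 0"
          using on(3) i by (simp add: orthonormal_def)
      qed
    qed
    then have "cos (\<theta> ! m) \<le> cos (\<theta>' ! k)"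
      using x(2) y(2,3) by simp
    moreover have "\<theta> ! m \<in> {0..pi/2}" "\<theta>' ! k \<in> {0..pi/2}"
      using tup tup' m k by (auto simp: angle_tuple_def subset_iff)
    ultimately show ?thesis
      using cos_mono_le_eq[of "\<theta> ! m" "\<theta>' ! k"] by (simp add: m_def)
  qed
  show ?thesis
  proof (rule list_all2_all_nthI)
    show "length (replicate (fdim V - fdim V') 0 @ \<theta>') = length \<theta>"
      using tup tup' le by (simp add: angle_tuple_def lens)
    fix n assume "n < length (replicate (fdim V - fdim V') 0 @ \<theta>')"
    then have n: "n < length e"
      using tup' le by (simp add: angle_tuple_def lens)
    show "(replicate (fdim V - fdim V') 0 @ \<theta>') ! n \<le> \<theta> ! n"
    proof (cases "n < length e - length e'")
      case True
      then show ?thesis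
        using tup n by (auto simp: nth_append lens angle_tuple_def subset_iff)
    next
      case False
      then show ?thesis
        using shifted[of "n - (length e - length e')"] n le by (simp add: nth_append lens)
    qed
  qed
qed

text \<open>
The partners of the principal vectors of \<open>V\<close> span a subspace of \<open>W\<close> that contains the projection of
\<open>V\<close> to \<open>W\<close>; replacing \<open>W\<close> by it loses no angle.
\<close>

lemma principal_angles_subspace:
  assumes "principal_angles V W \<theta>" "fdim V \<le> fdim W"
  obtains U where "U \<in> Gr (fdim V) W" "principal_angles V U \<theta>"
proof -
  obtain e f where ef: "principal_bases e f \<theta>" "fspan (set e) = V" "fspan (set f) = W"
    using assms(1) unfolding principal_angles_iff by blast
  have on: "orthonormal e" "orthonormal f"
    using ef(1) by (auto simp: principal_bases_def)
  have lens: "fdim V = length e" "fdim W = length f"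
    using fdim_orthonormal ef(2,3) on by metis+
  define g where "g = take (length e) f"
  have len_g: "length g = length e" using assms(2) by (simp add: g_def lens)
  have g: "orthonormal g" using on by (simp add: g_def orthonormal_take)
  have "fspan (set g) \<subseteq> W"
    unfolding ef(3)[symmetric] g_def by (intro fsp.span_mono set_take_subset)
  then have "fspan (set g) \<in> Gr (fdim V) W"
    using fdim_orthonormal[OF g] len_g unfolding Gr_def lens by (simp del: fsp.dim_span)
  moreover have "principal_bases e g \<theta>"
    using ef(1) g len_g assms(2) by (auto simp: principal_bases_def g_def lens min_def)
  then have "principal_angles V (fspan (set g)) \<theta>"
    unfolding principal_angles_iff using ef(2) by blast
  ultimately show ?thesis using that by blast
qed

lemma orthonormal_append:
  "orthonormal (g @ e)" if "orthonormal g" "orthonormal e"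
    "\<And>x y. x \<in> set g \<Longrightarrow> y \<in> set e \<Longrightarrow> hinner x y = 0"
  using that
proof (induction g)
  case (Cons x g)
  then have "\<forall>y\<in>set e. hinner y x = 0"
    by (metis hinner_eq_0_commute list.set_intros(1))
  with Cons show ?case by (auto simp: orthonormal_Cons)
qed simp

text \<open>
Adjoining common orthogonal directions to both spaces adds principal angles \<open>0\<close>.
\<close>

lemma principal_bases_append:
  assumes pb: "principal_bases e f \<theta>" and g: "orthonormal g"
    and orth: "\<And>x y. x \<in> set g \<Longrightarrow> y \<in> set e \<union> set f \<Longrightarrow> hinner x y = 0"
  shows "principal_bases (g @ e) (g @ f) (replicate (length g) 0 @ \<theta>)"
proof -
  have orth': "hinner y x = 0" if "x \<in> set g" "y \<in> set e \<union> set f" for x y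
    using orth[OF that] hinner_eq_0_commute by blast
  have "orthonormal (g @ e)" "orthonormal (g @ f)"
    using pb g orth by (auto simp: principal_bases_def intro!: orthonormal_append)
  moreover have "angle_tuple (min (length (g @ e)) (length (g @ f))) (replicate (length g) 0 @ \<theta>)"
    using pb by (auto simp: principal_bases_def angle_tuple_def sorted_append)
  moreover have "hinner ((g @ e) ! i) ((g @ f) ! j) =
      (if i = j then of_real (cos ((replicate (length g) 0 @ \<theta>) ! i)) else 0)"
    if "i < length (g @ e)" "j < length (g @ f)" for i j
    using that pb g orth orth'
    by (auto simp: principal_bases_def orthonormal_def nth_append)
  ultimately show ?thesis
    by (simp add: principal_bases_def)
qed

section \<open>Subspaces of the coordinate spaces\<close>

definition std :: "nat \<Rightarrow> ('a :: real_or_complex) fseq" where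
  "std i = Poly_Mapping.single i 1"

lemma hinner_std: "hinner x (std i) = Poly_Mapping.lookup x i"
proof -
  have "hinner x (std i) = cjg (hinner (std i) x)" by (rule hinner_commute)
  also have "hinner (std i) x = cjg (Poly_Mapping.lookup x i)"
    by (simp add: hinner_def std_def)
  finally show ?thesis by simp
qed

lemma hinner_std_std: "hinner (std i) (std j) = (if i = j then 1 else 0)"
  unfolding hinner_std by (simp add: std_def lookup_single)

lemma orthonormal_std: "orthonormal (map std [m..<n])"
  by (auto simp: orthonormal_def hinner_std_std)

lemma std_in_coord_space: "std i \<in> coord_space n \<longleftrightarrow> i < n"
  by (auto simp: coord_space_def std_def lookup_single when_def)

lemma fsubspace_coord_space: "fsubspace (coord_space n)"
  by (auto simp: fsp.subspace_def coord_space_def lookup_add scl.rep_eq)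

lemma coord_space_mono: "m \<le> n \<Longrightarrow> coord_space m \<subseteq> coord_space n"
  by (auto simp: coord_space_def)

lemma coord_space_subset_span: "coord_space n \<subseteq> fspan (std ` {..<n})"
proof
  fix x :: "'a fseq"
  assume x: "x \<in> coord_space n"
  have "x = (\<Sum>i<n. scl (Poly_Mapping.lookup x i) (std i))"
  proof (rule poly_mapping_eqI)
    fix k
    have "Poly_Mapping.lookup (\<Sum>i<n. scl (Poly_Mapping.lookup x i) (std i)) k =
        (\<Sum>i<n. if i = k then Poly_Mapping.lookup x k else 0)"
      unfolding lookup_sum by (intro sum.cong) (auto simp: scl.rep_eq std_def lookup_single when_def)
    also have "\<dots> = Poly_Mapping.lookup x k"
      using x by (auto simp: coord_space_def)
    finally show "Poly_Mapping.lookup x k = Poly_Mapping.lookup (\<Sum>i<n. scl (Poly_Mapping.lookup x i) (std i)) k" ..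
  qed
  then show "x \<in> fspan (std ` {..<n})"
    by (metis (no_types, lifting) fsp.span_sum fsp.span_scale fsp.span_base imageI)
qed

lemma full_Gr_orthonormal_basis:
  assumes "V \<in> full_Gr_inf"
  obtains e where "orthonormal_basis e V"
proof -
  obtain n where V: "fsubspace V" "V \<subseteq> coord_space n"
    using assms by (auto simp: full_Gr_inf_def full_Gr_def)
  obtain B where B: "B \<subseteq> V" "fsp.independent B" "V \<subseteq> fspan B"
    using fsp.basis_exists[of V] by metis
  have "finite B"
    using fsp.independent_span_bound[of "std ` {..<n}" B] B V coord_space_subset_span by blast
  moreover have "fspan B = V"
    using B V(1) by (simp add: fsp.span_subspace)
  ultimately show thesis
    using orthonormal_basis_exists that by metis
qed

lemma Gr_inf_iff: "V \<in> Gr_inf p \<longleftrightarrow> V \<in> full_Gr_inf \<and> fdim V = p"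
  by (auto simp: Gr_inf_def Gr_def full_Gr_inf_def full_Gr_def)

lemma Gr_subset_Gr_inf:
  assumes "W \<in> full_Gr_inf"
  shows "Gr p W \<subseteq> Gr_inf p"
  using assms by (fastforce simp: Gr_inf_def Gr_def full_Gr_inf_def full_Gr_def)

lemma Gr_dim_self:
  fixes W :: "('a :: real_or_complex) fseq set"
  assumes "W \<in> full_Gr_inf"
  shows "Gr (fdim W) W = {W}"
proof
  show "{W} \<subseteq> Gr (fdim W) W"
    using assms by (auto simp: Gr_def full_Gr_inf_def full_Gr_def)
  show "Gr (fdim W) W \<subseteq> {W}"
  proof
    fix U assume U: "U \<in> Gr (fdim W) W"
    then have "U \<in> full_Gr_inf"
      using Gr_subset_Gr_inf[OF assms, of "fdim W"] by (auto simp: Gr_inf_iff)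
    then obtain a where a: "orthonormal_basis a U" by (rule full_Gr_orthonormal_basis)
    obtain b where b: "orthonormal_basis b W" using assms by (rule full_Gr_orthonormal_basis)
    have "U \<subseteq> W" "fdim U = fdim W" using U by (auto simp: Gr_def)
    have on: "orthonormal a" "fspan (set a) = U" "orthonormal b" "fspan (set b) = W"
      using a b by (simp_all add: orthonormal_basis_iff)
    have len: "length a = length b"
      using \<open>fdim U = fdim W\<close> orthonormal_basis_length[OF a] orthonormal_basis_length[OF b] by simp
    have "W \<subseteq> U"
    proof (rule ccontr)
      assume "\<not> W \<subseteq> U"
      then obtain y where y: "y \<in> W" "y \<notin> U" by blast
      then have "fsp.independent (insert y (set a))"
        using on orthonormal_independent by (intro fsp.independent_insertI) auto
      moreover have "insert y (set a) \<subseteq> fspan (set b)"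
        using y(1) on \<open>U \<subseteq> W\<close> fsp.span_superset by blast
      ultimately have "card (insert y (set a)) \<le> card (set b)"
        using fsp.independent_span_bound[of "set b"] by blast
      moreover have "y \<notin> set a" using y(2) on(2) fsp.span_base by blast
      ultimately show False
        using len on by (simp add: distinct_card orthonormal_distinct)
    qed
    with \<open>U \<subseteq> W\<close> show "U \<in> {W}" by blast
  qed
qed

lemma Gr_nonempty:
  fixes W :: "('a :: real_or_complex) fseq set"
  assumes "W \<in> full_Gr_inf" "p \<le> fdim W"
  shows "Gr p W \<noteq> {}"
proof -
  obtain b where b: "orthonormal b" "fspan (set b) = W"
    using assms(1) by (meson full_Gr_orthonormal_basis orthonormal_basis_iff)
  then have "length b = fdim W" by (metis fdim_orthonormal)
  then have "fdim (fspan (set (take p b))) = p"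
    using fdim_orthonormal[OF orthonormal_take[OF b(1), of p]] assms(2) by simp
  moreover have "fspan (set (take p b)) \<subseteq> W"
    unfolding b(2)[symmetric] by (intro fsp.span_mono set_take_subset)
  ultimately have "fspan (set (take p b)) \<in> Gr p W"
    unfolding Gr_def by blast
  then show ?thesis by blast
qed

lemma Gr_empty_iff:
  fixes W :: "('a :: real_or_complex) fseq set"
  assumes "W \<in> full_Gr_inf"
  shows "Gr p W = {} \<longleftrightarrow> fdim W < p"
proof -
  have "p \<le> fdim W" if "U \<in> Gr p W" for U
  proof -
    have U: "U \<in> full_Gr_inf" "U \<subseteq> W" "fdim U = p"
      using that Gr_subset_Gr_inf[OF assms, of p] by (auto simp: Gr_inf_iff) (auto simp: Gr_def)
    obtain a where a: "orthonormal_basis a U" using U(1) by (rule full_Gr_orthonormal_basis)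
    obtain b where b: "orthonormal_basis b W" using assms by (rule full_Gr_orthonormal_basis)
    have "length a \<le> length b"
      using a b U(2) by (intro fdim_mono_orthonormal) (simp_all add: orthonormal_basis_iff)
    then show ?thesis
      using orthonormal_basis_length[OF a] orthonormal_basis_length[OF b] U(3) by simp
  qed
  then show ?thesis
    using Gr_nonempty[OF assms] by (metis all_not_in_conv not_le)
qed

lemma principal_angles_full_Gr:
  assumes "V \<in> full_Gr_inf" "W \<in> full_Gr_inf"
  obtains \<theta> where "principal_angles V W \<theta>"
proof -
  obtain a where "orthonormal_basis a V" using assms(1) by (rule full_Gr_orthonormal_basis)
  moreover obtain b where "orthonormal_basis b W" using assms(2) by (rule full_Gr_orthonormal_basis)
  ultimately show thesis
    using principal_angles_exist[of a b] that by (auto simp: orthonormal_basis_iff)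
qed

text \<open>
Both subspaces lie in a common \<open>\<F>\<^sup>n\<close>, and the basis vectors of \<open>\<F>\<^sup>n\<^sup>+\<^sup>(\<^sup>q\<^sup>-\<^sup>p\<^sup>)\<close> beyond \<open>\<F>\<^sup>n\<close> supply the common
orthogonal directions.  It is here that infinitely many coordinates are essential.
\<close>

lemma principal_angles_stabilise:
  fixes V W :: "('a :: real_or_complex) fseq set"
  assumes "V \<in> Gr_inf p" "W \<in> Gr_inf p" "principal_angles V W \<theta>" "p \<le> q"
  obtains V1 W1 :: "'a fseq set" where "V1 \<in> Gr_inf q" "W1 \<in> Gr_inf q"
    "principal_angles V1 W1 (replicate (q - p) 0 @ \<theta>)"
proof -
  obtain n1 n2 where "V \<subseteq> coord_space n1" "W \<subseteq> coord_space n2"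
    using assms by (auto simp: Gr_inf_def Gr_def)
  then obtain n where n: "V \<subseteq> coord_space n" "W \<subseteq> coord_space n"
    using coord_space_mono[of n1 "max n1 n2"] coord_space_mono[of n2 "max n1 n2"]
    by (metis max.cobounded1 max.cobounded2 subset_trans)
  obtain e f where ef: "principal_bases e f \<theta>" "fspan (set e) = V" "fspan (set f) = W"
    using assms(3) unfolding principal_angles_iff by blast
  define g :: "'a fseq list" where "g = map std [n..<n + (q - p)]"
  have len_g: "length g = q - p" by (simp add: g_def)
  have on: "orthonormal e" "orthonormal f" using ef(1) by (auto simp: principal_bases_def)
  have lens: "length e = p" "length f = p"
    using fdim_orthonormal on ef(2,3) assms(1,2) by (metis Gr_inf_iff)+
  have sub: "set e \<union> set f \<subseteq> coord_space n"
    using n ef(2,3) fsp.span_base by blast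
  have pb: "principal_bases (g @ e) (g @ f) (replicate (length g) 0 @ \<theta>)"
  proof (rule principal_bases_append[OF ef(1)])
    show "orthonormal g" unfolding g_def by (rule orthonormal_std)
    fix x y assume "x \<in> set g" "y \<in> set e \<union> set f"
    then have "hinner y x = 0"
      using sub by (auto simp: g_def hinner_std coord_space_def)
    then show "hinner x y = 0" by (simp add: hinner_eq_0_commute)
  qed
  have in_Gr: "fspan (set (g @ h)) \<in> Gr_inf q"
    if "orthonormal (g @ h)" "length h = p" "set h \<subseteq> coord_space n" for h
  proof -
    have "set (g @ h) \<subseteq> coord_space (n + (q - p))"
      using that(3) coord_space_mono[of n "n + (q - p)"]
      by (auto simp: g_def std_in_coord_space)
    then have "fspan (set (g @ h)) \<subseteq> coord_space (n + (q - p))"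
      by (intro fsp.span_minimal fsubspace_coord_space)
    moreover have "fdim (fspan (set (g @ h))) = q"
      using fdim_orthonormal[OF that(1)] that(2) assms(4) len_g by simp
    ultimately show ?thesis
      unfolding Gr_inf_def Gr_def using fsp.subspace_span by blast
  qed
  show thesis
  proof (rule that)
    show "fspan (set (g @ e)) \<in> Gr_inf q" "fspan (set (g @ f)) \<in> Gr_inf q"
      using pb lens sub by (auto intro!: in_Gr simp: principal_bases_def simp del: set_append)
    show "principal_angles (fspan (set (g @ e))) (fspan (set (g @ f))) (replicate (q - p) 0 @ \<theta>)"
      using pb unfolding principal_angles_iff len_g by blast
  qed
qed

text \<open>
The spans of the coordinates \<open>0, \<dots>, p - 1\<close> and \<open>1, \<dots>, p\<close> differ, as the second is orthogonal to
the basis vector of index \<open>0\<close>.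
\<close>

lemma Gr_inf_two_points:
  assumes "p \<noteq> 0"
  obtains V W :: "('a :: real_or_complex) fseq set" where "V \<in> Gr_inf p" "W \<in> Gr_inf p" "V \<noteq> W"
proof -
  have in_Gr: "fspan (set (map std [m..<m + p])) \<in> (Gr_inf p :: 'a fseq set set)" for m
  proof -
    have "fspan (set (map std [m..<m + p])) \<subseteq> (coord_space (m + p) :: 'a fseq set)"
      by (intro fsp.span_minimal fsubspace_coord_space) (auto simp: std_in_coord_space)
    moreover have "fdim (fspan (set (map std [m..<m + p])) :: 'a fseq set) = p"
      using fdim_orthonormal[OF orthonormal_std[of m "m + p"]] by simp
    ultimately show ?thesis
      unfolding Gr_inf_def Gr_def using fsp.subspace_span by blast
  qed
  have "(std 0 :: 'a fseq) \<in> fspan (set (map std [0..<0 + p]))"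
    using assms by (intro fsp.span_base) auto
  moreover have "(std 0 :: 'a fseq) \<notin> fspan (set (map std [1..<1 + p]))"
  proof
    assume "(std 0 :: 'a fseq) \<in> fspan (set (map std [1..<1 + p]))"
    then have "hinner (std 0 :: 'a fseq) (std 0) = 0"
      by (rule hinner_span_0) (auto simp: hinner_std_std)
    then show False by (simp add: hinner_std_std)
  qed
  ultimately show thesis
    using that[OF in_Gr[of 0] in_Gr[of 1]] by blast
qed

lemma Gr_inf_0: "Gr_inf 0 = {{0 :: ('a :: real_or_complex) fseq}}"
proof -
  have "V = {0}" if "V \<in> Gr_inf 0" for V :: "'a fseq set"
  proof -
    have V: "V \<in> full_Gr_inf" "fdim V = 0" using that by (simp_all add: Gr_inf_iff)
    obtain e where "orthonormal_basis e V" using V(1) by (rule full_Gr_orthonormal_basis)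
    with V(2) show ?thesis
      using orthonormal_basis_length[of e V] by (auto simp: orthonormal_basis_iff)
  qed
  moreover have "{0} \<in> (Gr_inf 0 :: 'a fseq set set)"
  proof -
    have "fspan {} \<in> (Gr_inf 0 :: 'a fseq set set)"
      using fdim_orthonormal[of "[]"] fsp.subspace_span[of "{}"]
      by (auto simp: Gr_inf_def Gr_def orthonormal_def coord_space_def simp del: fsp.dim_span)
    then show ?thesis by simp
  qed
  ultimately show ?thesis by blast
qed

section \<open>The asymmetric metric on the full Grassmannian\<close>

text \<open>
Lets the triangle inequality be checked on competitors of each infimum separately.
\<close>

lemma ennreal_le_add_Inf:
  fixes x a :: ennreal
  assumes "\<And>s. s \<in> S \<Longrightarrow> x \<le> a + s"
  shows "x \<le> a + Inf S"
proof (cases "a = top")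
  case False
  then have "x - a \<le> Inf S"
    using assms by (intro Inf_greatest) (simp add: ennreal_minus_le_iff)
  with False show ?thesis by (simp add: ennreal_minus_le_iff)
qed simp

locale principal_angle_metrics =
  fixes d :: "nat \<Rightarrow> ('a :: real_or_complex) fseq set \<Rightarrow> 'a fseq set \<Rightarrow> ennreal"
    and f :: "nat \<Rightarrow> real list \<Rightarrow> ennreal"
  assumes metric: "\<And>p. ext_metric_on (Gr_inf p) (d p)"
    and mono: "\<And>p. p \<noteq> 0 \<Longrightarrow> nondecreasing_angle_fun p (f p)"
    and d_eq_f: "\<And>p V W \<theta>. p \<noteq> 0 \<Longrightarrow> V \<in> Gr_inf p \<Longrightarrow> W \<in> Gr_inf p \<Longrightarrow>
              principal_angles V W \<theta> \<Longrightarrow> d p V W = f p \<theta>"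
    and f_pad: "\<And>p q \<theta>. p \<noteq> 0 \<Longrightarrow> p < q \<Longrightarrow> angle_tuple p \<theta> \<Longrightarrow>
               f q (replicate (q - p) 0 @ \<theta>) = f p \<theta>"
begin

definition diam :: "nat \<Rightarrow> ennreal" where
  "diam p = diam_on (Gr_inf p) (d p)"

definition dist_Gr :: "'a fseq set \<Rightarrow> 'a fseq set \<Rightarrow> ennreal" where
  "dist_Gr V W = Inf_upto (diam (fdim V)) {d (fdim V) V W' | W'. W' \<in> Gr (fdim V) W}"

lemma f_pad_le:
  assumes "p \<noteq> 0" "p \<le> q" "angle_tuple p \<theta>"
  shows "f q (replicate (q - p) 0 @ \<theta>) = f p \<theta>"
  using assms f_pad[of p q \<theta>] by (cases "p = q") auto

lemma d_le_diam: "V \<in> Gr_inf p \<Longrightarrow> W \<in> Gr_inf p \<Longrightarrow> d p V W \<le> diam p"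
  unfolding diam_def diam_on_def by (intro Sup_upper) blast

lemma d_eq_0_iff: "V \<in> Gr_inf p \<Longrightarrow> W \<in> Gr_inf p \<Longrightarrow> d p V W = 0 \<longleftrightarrow> V = W"
  using metric[of p] by (simp add: ext_metric_on_def)

lemma d_triangle:
  "U \<in> Gr_inf p \<Longrightarrow> V \<in> Gr_inf p \<Longrightarrow> W \<in> Gr_inf p \<Longrightarrow> d p U W \<le> d p U V + d p V W"
  using metric[of p] by (simp add: ext_metric_on_def)

lemma diam_pos:
  assumes "p \<noteq> 0"
  shows "diam p \<noteq> 0"
proof -
  obtain V W :: "'a fseq set" where VW: "V \<in> Gr_inf p" "W \<in> Gr_inf p" "V \<noteq> W"
    using Gr_inf_two_points[OF assms] .
  then have "d p V W \<noteq> 0" by (simp add: d_eq_0_iff)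
  then show ?thesis
    using d_le_diam[OF VW(1,2)] by auto
qed

text \<open>
Every distance in dimension \<open>p\<close> recurs in dimension \<open>q\<close>, by adjoining \<open>q - p\<close> common directions and
applying \<open>f_pad\<close>.
\<close>

lemma diam_mono:
  assumes "p \<le> q"
  shows "diam p \<le> diam q"
proof -
  have "d p V W \<le> diam q" if VW: "V \<in> Gr_inf p" "W \<in> Gr_inf p" for V W
  proof (cases "p = 0")
    case True
    have "V = W" using VW unfolding True Gr_inf_0 by blast
    then have "d p V W = 0" using VW by (simp add: d_eq_0_iff)
    then show ?thesis by simp
  next
    case False
    obtain \<theta> where \<theta>: "principal_angles V W \<theta>"
      using principal_angles_full_Gr[of V W] VW by (auto simp: Gr_inf_iff)
    then have tup: "angle_tuple p \<theta>"
      using VW by (simp add: principal_angles_def Gr_inf_iff)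
    obtain V1 W1 :: "'a fseq set" where V1: "V1 \<in> Gr_inf q" "W1 \<in> Gr_inf q"
      "principal_angles V1 W1 (replicate (q - p) 0 @ \<theta>)"
      using principal_angles_stabilise[OF VW \<theta> assms] .
    have "d p V W = f p \<theta>" using False VW \<theta> by (rule d_eq_f)
    also have "\<dots> = f q (replicate (q - p) 0 @ \<theta>)"
      using f_pad_le[OF False assms tup] ..
    also have "\<dots> = d q V1 W1"
      using d_eq_f[OF _ V1] False assms by simp
    also have "\<dots> \<le> diam q" using V1 by (intro d_le_diam)
    finally show ?thesis .
  qed
  then show ?thesis
    unfolding diam_def[of p] diam_on_def by (auto intro!: Sup_least)
qed

text \<open>
The heart of the triangle inequality: passing from \<open>V\<close> to a subspace \<open>V'\<close>, one finds inside \<open>W\<close> a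
subspace at least as close to \<open>V'\<close> as \<open>W\<close> is to \<open>V\<close>.  One takes the span of the partners in \<open>W\<close> of
the principal vectors of \<open>V'\<close>; interlacing, monotonicity and \<open>f_pad\<close> compare the distances.
\<close>

lemma subspace_approximation:
  assumes V: "V \<in> Gr_inf q" and W: "W \<in> Gr_inf q" and V': "V' \<in> Gr p V" and "p \<le> q"
  obtains W' where "W' \<in> Gr p W" "d p V' W' \<le> d q V W"
proof -
  have full: "V \<in> full_Gr_inf" "W \<in> full_Gr_inf" "fdim V = q" "fdim W = q"
    using V W by (simp_all add: Gr_inf_iff)
  have V'_inf: "V' \<in> Gr_inf p" "V' \<subseteq> V" "V' \<in> full_Gr_inf" "fdim V' = p"
    using V' Gr_subset_Gr_inf[OF full(1), of p] by (auto simp: Gr_inf_iff) (auto simp: Gr_def)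
  show thesis
  proof (cases "p = 0")
    case True
    obtain W' where W': "W' \<in> Gr p W"
      using Gr_empty_iff[OF full(2), of p] True by blast
    then have "W' \<in> Gr_inf p" using Gr_subset_Gr_inf[OF full(2)] by blast
    then have "W' = V'" using V'_inf(1) unfolding True Gr_inf_0 by blast
    then have "d p V' W' = 0" using d_eq_0_iff V'_inf(1) by simp
    with W' that show ?thesis by simp
  next
    case False
    obtain \<theta> where \<theta>: "principal_angles V W \<theta>"
      using full(1,2) by (rule principal_angles_full_Gr)
    obtain \<theta>' where \<theta>': "principal_angles V' W \<theta>'"
      using V'_inf(3) full(2) by (rule principal_angles_full_Gr)
    obtain W' where W': "W' \<in> Gr p W" "principal_angles V' W' \<theta>'"
      using principal_angles_subspace[OF \<theta>'] V'_inf(4) full(4) \<open>p \<le> q\<close> by metis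
    have W'_inf: "W' \<in> Gr_inf p"
      using W'(1) Gr_subset_Gr_inf[OF full(2)] by blast
    have tup: "angle_tuple q \<theta>" "angle_tuple p \<theta>'"
      using \<theta> \<theta>' full(3,4) V'_inf(4) \<open>p \<le> q\<close> by (simp_all add: principal_angles_def)
    then have tup0: "angle_tuple q (replicate (q - p) 0 @ \<theta>')"
      using \<open>p \<le> q\<close> by (auto simp: angle_tuple_def sorted_append)
    have le: "list_all2 (\<le>) (replicate (q - p) 0 @ \<theta>') \<theta>"
      using principal_angles_interlacing[OF \<theta> \<theta>' V'_inf(2)] full V'_inf(4) by simp
    have "d p V' W' = f p \<theta>'"
      using d_eq_f[OF False V'_inf(1) W'_inf W'(2)] .
    also have "\<dots> = f q (replicate (q - p) 0 @ \<theta>')"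
      using f_pad_le[OF False \<open>p \<le> q\<close> tup(2)] ..
    also have "\<dots> \<le> f q \<theta>"
      using mono[of q] le tup(1) tup0 False \<open>p \<le> q\<close> by (simp add: nondecreasing_angle_fun_def)
    also have "\<dots> = d q V W"
      using d_eq_f[OF _ V W \<theta>] False \<open>p \<le> q\<close> by simp
    finally show ?thesis using that W'(1) by blast
  qed
qed

lemma dist_Gr_le_diam: "dist_Gr V W \<le> diam (fdim V)"
  by (simp add: dist_Gr_def Inf_upto_eq)

lemma dist_Gr_le: "W' \<in> Gr (fdim V) W \<Longrightarrow> dist_Gr V W \<le> d (fdim V) V W'"
  unfolding dist_Gr_def Inf_upto_eq by (intro min.coboundedI2 Inf_lower) blast

lemma dist_Gr_larger_dim:
  assumes "W \<in> full_Gr_inf" "fdim W < fdim V"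
  shows "dist_Gr V W = diam (fdim V)"
proof -
  have "Gr (fdim V) W = {}" using assms by (simp add: Gr_empty_iff)
  then show ?thesis by (simp add: dist_Gr_def Inf_upto_empty)
qed

lemma dist_Gr_eq_Inf:
  assumes V: "V \<in> full_Gr_inf" and W: "W \<in> full_Gr_inf" and "fdim V \<le> fdim W"
  shows "dist_Gr V W = Inf {d (fdim V) V W' | W'. W' \<in> Gr (fdim V) W}"
proof -
  obtain W' where W': "W' \<in> Gr (fdim V) W"
    using Gr_empty_iff[OF W, of "fdim V"] assms(3) by auto
  then have "W' \<in> Gr_inf (fdim V)" "V \<in> Gr_inf (fdim V)"
    using V Gr_subset_Gr_inf[OF W, of "fdim V"] by (auto simp: Gr_inf_iff)
  then have "Inf {d (fdim V) V W' | W'. W' \<in> Gr (fdim V) W} \<le> diam (fdim V)"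
    using W' d_le_diam by (blast intro: Inf_lower2)
  then show ?thesis
    by (simp add: dist_Gr_def Inf_upto_eq min_absorb2)
qed

lemma dist_Gr_same_dim:
  assumes V: "V \<in> full_Gr_inf" and W: "W \<in> full_Gr_inf" and "fdim V = fdim W"
  shows "dist_Gr V W = d (fdim V) V W"
  using dist_Gr_eq_Inf[OF V W] assms(3) Gr_dim_self[OF W] by simp

text \<open>
If the dimensions differ, the distance from the larger space to the smaller one is a diameter, which
is positive; if they agree, both distances are values of the metric of that dimension.
\<close>

lemma dist_Gr_eq_0_iff:
  assumes V: "V \<in> full_Gr_inf" and W: "W \<in> full_Gr_inf"
  shows "dist_Gr V W = 0 \<and> dist_Gr W V = 0 \<longleftrightarrow> V = W"
proof (cases "fdim V" "fdim W" rule: linorder_cases)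
  case less
  then show ?thesis using dist_Gr_larger_dim[OF V less] diam_pos[of "fdim W"] by auto
next
  case equal
  have "V \<in> Gr_inf (fdim V)" "W \<in> Gr_inf (fdim V)"
    using V W equal by (simp_all add: Gr_inf_iff)
  then show ?thesis
    using dist_Gr_same_dim[OF V W equal] dist_Gr_same_dim[OF W V equal[symmetric]] equal
      d_eq_0_iff[of V "fdim V" W] d_eq_0_iff[of W "fdim V" V] by auto
next
  case greater
  then show ?thesis using dist_Gr_larger_dim[OF W greater] diam_pos[of "fdim V"] by auto
qed

text \<open>
If \<open>dim V < dim U\<close> or \<open>dim W < dim V\<close>, a summand on the right is a diameter no smaller than that of
the dimension of \<open>U\<close>, which bounds the left-hand side.  Otherwise let \<open>V'\<close> and \<open>W'\<close> compete in the two
infima on the right.  The subspace of \<open>W'\<close> that approximates \<open>V'\<close> competes on the left, and the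
triangle inequality for \<open>p\<close>-dimensional subspaces applies.
\<close>

lemma dist_Gr_triangle:
  assumes U: "U \<in> full_Gr_inf" and V: "V \<in> full_Gr_inf" and W: "W \<in> full_Gr_inf"
  shows "dist_Gr U W \<le> dist_Gr U V + dist_Gr V W"
proof -
  define p q where "p = fdim U" and "q = fdim V"
  note pq = p_def[symmetric] q_def[symmetric]
  consider "q < p" | "p \<le> q" "fdim W < q" | "p \<le> q" "q \<le> fdim W" by linarith
  then show ?thesis
  proof cases
    case 1
    then have "dist_Gr U V = diam p"
      using dist_Gr_larger_dim[OF V] by (simp add: pq)
    then show ?thesis
      using dist_Gr_le_diam[of U W] by (simp add: pq add_increasing2)
  next
    case 2
    have "dist_Gr U W \<le> diam p" using dist_Gr_le_diam[of U W] by (simp add: pq)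
    also have "\<dots> \<le> diam q" using 2(1) by (rule diam_mono)
    also have "\<dots> = dist_Gr V W" using dist_Gr_larger_dim[OF W] 2(2) by (simp add: pq)
    finally show ?thesis by (simp add: add_increasing)
  next
    case 3
    have step: "dist_Gr U W \<le> d p U V' + d q V W'" if V': "V' \<in> Gr p V" and W': "W' \<in> Gr q W" for V' W'
    proof -
      have inf: "U \<in> Gr_inf p" "V \<in> Gr_inf q" "V' \<in> Gr_inf p" "W' \<in> Gr_inf q"
        using U V V' W' Gr_subset_Gr_inf[OF V] Gr_subset_Gr_inf[OF W]
        by (auto simp: Gr_inf_iff[of U] Gr_inf_iff[of V] pq)
      obtain W'' where W'': "W'' \<in> Gr p W'" "d p V' W'' \<le> d q V W'"
        using subspace_approximation[OF inf(2,4) V' 3(1)] .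
      have "W'' \<in> Gr p W"
        using W''(1) W' by (auto simp: Gr_def)
      then have "W'' \<in> Gr_inf p" and le: "dist_Gr U W \<le> d p U W''"
        using Gr_subset_Gr_inf[OF W] dist_Gr_le[of W'' U W] by (auto simp: pq)
      then have "d p U W'' \<le> d p U V' + d p V' W''"
        using inf by (intro d_triangle)
      also have "\<dots> \<le> d p U V' + d q V W'"
        using W''(2) by (rule add_left_mono)
      finally show ?thesis using le by order
    qed
    have "dist_Gr U W \<le> dist_Gr V W + d p U V'" if V': "V' \<in> Gr p V" for V'
    proof -
      have "dist_Gr U W \<le> d p U V' + Inf {d q V W' | W'. W' \<in> Gr q W}"
        using step[OF V'] by (intro ennreal_le_add_Inf) blast
      then show ?thesis
        using dist_Gr_eq_Inf[OF V W] 3(2) by (simp add: pq add.commute)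
    qed
    then have "dist_Gr U W \<le> dist_Gr V W + Inf {d p U V' | V'. V' \<in> Gr p V}"
      by (intro ennreal_le_add_Inf) blast
    then show ?thesis
      using dist_Gr_eq_Inf[OF U V] 3(1) by (simp add: pq add.commute)
  qed
qed

lemma asymmetric_metric_dist_Gr: "asymmetric_metric_on full_Gr_inf dist_Gr"
proof -
  have "{0} \<in> (full_Gr_inf :: 'a fseq set set)"
    using Gr_inf_0 Gr_inf_iff by blast
  then show ?thesis
    unfolding asymmetric_metric_on_def
    using dist_Gr_eq_0_iff dist_Gr_triangle by blast
qed

end

theorem theorem5p1:
  fixes d :: "nat \<Rightarrow> ('a :: real_or_complex) fseq set \<Rightarrow> 'a fseq set \<Rightarrow> ennreal"
    and f :: "nat \<Rightarrow> real list \<Rightarrow> ennreal"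
  assumes metric: "\<And>p. ext_metric_on (Gr_inf p) (d p)"
    and mono: "\<And>p. p \<noteq> 0 \<Longrightarrow> nondecreasing_angle_fun p (f p)"
    and I: "\<And>p V W \<theta>. p \<noteq> 0 \<Longrightarrow> V \<in> Gr_inf p \<Longrightarrow> W \<in> Gr_inf p \<Longrightarrow>
              principal_angles V W \<theta> \<Longrightarrow> d p V W = f p \<theta>"
    and II: "\<And>p q \<theta>. p \<noteq> 0 \<Longrightarrow> p < q \<Longrightarrow> angle_tuple p \<theta> \<Longrightarrow>
               f q (replicate (q - p) 0 @ \<theta>) = f p \<theta>"
  shows "asymmetric_metric_on full_Gr_inf
           (\<lambda>V W. let p = fdim V in
              Inf_upto (diam_on (Gr_inf p) (d p)) {d p V W' | W'. W' \<in> Gr p W})"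
proof -
  interpret principal_angle_metrics d f
    using metric mono I II by unfold_locales
  have "(\<lambda>V W. let p = fdim V in
        Inf_upto (diam_on (Gr_inf p) (d p)) {d p V W' | W'. W' \<in> Gr p W}) = dist_Gr"
    by (simp add: fun_eq_iff Let_def dist_Gr_def diam_def)
  then show ?thesis
    using asymmetric_metric_dist_Gr by simp
qed

end
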